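(* Let $\mathbf G=G_1\times G_2$ be a product of two stratified Lie groups and let $\mathcal M_s$ be the strong maximal operator on $\mathbf G$. Then there is a constant $C$, depending only on $\mathbf G$, such that $$\bigl|\{\mathbf g\in\mathbf G:\ \mathcal M_sf(\mathbf g)>\lambda\}\bigr|\le C\,F_\Phi(f/\lambda)\qquad\text{for all }\lambda\in(0,\infty)\text{ and all } f\in\mathsf{L\,log\,L}(\mathbf G).$$
   Context: **Stratified groups.** A stratified Lie group $G$ is a (real, finite-dimensional, connected and simply connected) nilpotent Lie group whose Lie algebra is a vector space direct sum $\mathfrak g=\bigoplus_{j=1}^s\mathfrak v_j$ with $[\mathfrak v_1,\mathfrak v_j]=\mathfrak v_{j+1}$ for $1\le j\le s$, $\mathfrak v_{s+1}=\{0\}$. The dilations $\delta_t$ ($t>0$) act on $\mathfrak v_j$ by $t^j$ and are transferred to automorphisms of $G$ by $\exp$. Haar measure (bi-invariant) is Lebesgue measure on $\mathfrak g$ transferred by $\exp$; $|E|$ is the measure of $E$. $G$ carries a fixed homogeneous norm $\rho:G\to[0,\infty)$, continuous, smooth off the identity $o$, with $\rho(g^{-1})=\rho(g)$, $\rho(g^{-1}h)\le\rho(g)+\rho(h)$, $\rho(\delta_tg)=t\rho(g)$, and $\rho(g)=0$ iff $g=o$. Put $\rho(g,h)=\rho(g^{-1}h)$ (a left-invariant metric) and $B(g,r)=\{h:\rho(g,h)<r\}$. On $\mathbf G=G_1\times G_2$ use the product Haar measure $d\mathbf g$. **Strong maximal operator.** $\mathcal M_sf(\mathbf g)=\sup\bigl\{\frac1{|P|}\int_P|f(\mathbf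 h)|\,d\mathbf h\bigr\}$, the supremum over all products of balls $P=B_1(x_1,r_1)\times B_2(x_2,r_2)$ (with $x_i\in G_i$, $r_i>0$) that contain $\mathbf g$. **Orlicz space.** $\Phi(s)=s\log(\mathrm e+s)$, $F_\Phi(f)=\int_{\mathbf G}\Phi(|f(\mathbf g)|)\,d\mathbf g$; $\mathsf{L\,log\,L}(\mathbf G)$ is the set of $f\in L^1_{\rm loc}(\mathbf G)$ with finite Luxemburg norm $\inf\{\lambda>0:F_\Phi(f/\lambda)\le1\}$, equivalently with $F_\Phi(f)<\infty$. *)

theory Defs
  imports "HOL-Analysis.Analysis" "HOL-Algebra.Group"
begin

section \<open>Smooth maps between Euclidean spaces\<close>

text \<open>On an open set of a Euclidean space, \<open>f\<close> is of class $C^{k+1}$ iff it is differentiable and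
  each directional derivative \<open>\<lambda>x. f' x v\<close> is of class $C^k$.  Both notions below are meant for open
  \<open>S\<close> only.\<close>

primrec C_on :: "nat \<Rightarrow> 'a::euclidean_space set \<Rightarrow> ('a \<Rightarrow> 'b::real_normed_vector) \<Rightarrow> bool" where
  "C_on 0 S f \<longleftrightarrow> continuous_on S f"
| "C_on (Suc k) S f \<longleftrightarrow>
     (\<exists>f'. (\<forall>x\<in>S. (f has_derivative f' x) (at x)) \<and> (\<forall>v. C_on k S (\<lambda>x. f' x v)))"

definition smooth_on :: "'a::euclidean_space set \<Rightarrow> ('a \<Rightarrow> 'b::real_normed_vector) \<Rightarrow> bool" where
  "smooth_on S f \<longleftrightarrow> (\<forall>k. C_on k S f)"


section \<open>Stratified groups\<close>

text \<open>The Lie algebra of \<open>G\<close>, as a vector space, is the Euclidean space \<open>'v\<close>, and \<open>expG\<close> is the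
  exponential map.  For a connected, simply connected nilpotent Lie group it is a diffeomorphism of
  the Lie algebra onto the group, so its inverse is a global chart, and this chart is the one in
  which smoothness on \<open>G\<close> is expressed.\<close>

definition logG :: "('v \<Rightarrow> 'g) \<Rightarrow> 'g \<Rightarrow> 'v" where
  "logG expG = inv_into UNIV expG"

text \<open>\<open>Ad_map G expG g\<close> is the differential at the identity of the conjugation
  \<open>h \<mapsto> g \<otimes> h \<otimes> inv g\<close>, and the Lie bracket is the differential of \<open>g \<mapsto> Ad g\<close> at the identity.\<close>

definition Ad_map ::
  "('g, 'b) monoid_scheme \<Rightarrow> ('v::euclidean_space \<Rightarrow> 'g) \<Rightarrow> 'g \<Rightarrow> 'v \<Rightarrow> 'v" where
  "Ad_map G expG g Y =
     vector_derivative (\<lambda>t::real. logG expG (g \<otimes>\<^bsub>G\<^esub> expG (t *\<^sub>R Y) \<otimes>\<^bsub>G\<^esub> inv\<^bsub>G\<^esub> g)) (at 0)"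

definition lie_bracket ::
  "('g, 'b) monoid_scheme \<Rightarrow> ('v::euclidean_space \<Rightarrow> 'g) \<Rightarrow> 'v \<Rightarrow> 'v \<Rightarrow> 'v" where
  "lie_bracket G expG X Y = vector_derivative (\<lambda>t::real. Ad_map G expG (expG (t *\<^sub>R X)) Y) (at 0)"

definition layer_parts :: "nat \<Rightarrow> (nat \<Rightarrow> 'v::euclidean_space set) \<Rightarrow> 'v \<Rightarrow> nat \<Rightarrow> 'v" where
  "layer_parts s V x = (THE c. c \<in> (\<Pi>\<^sub>E j\<in>{1..s}. V j) \<and> x = (\<Sum>j=1..s. c j))"

definition dilation ::
  "('v::euclidean_space \<Rightarrow> 'g) \<Rightarrow> nat \<Rightarrow> (nat \<Rightarrow> 'v set) \<Rightarrow> real \<Rightarrow> 'g \<Rightarrow> 'g" where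
  "dilation expG s V t g = expG (\<Sum>j=1..s. t ^ j *\<^sub>R layer_parts s V (logG expG g) j)"

text \<open>Condition \<open>one_parameter\<close> says that \<open>expG\<close> is the exponential map: the curve
  \<open>t \<mapsto> expG (t *\<^sub>R x)\<close> is the one-parameter subgroup whose velocity at the identity, in the chart
  \<open>logG expG\<close>, is \<open>x\<close>.  It also gives \<open>inv (expG x) = expG (- x)\<close>, so inversion is smooth.
  Connectedness and simple connectedness of \<open>G\<close> follow from \<open>homeo\<close>, and nilpotency from the
  stratification.  The bracket of two layers is the linear span of the brackets of their elements.\<close>

locale stratified_group = group G
  for G :: "('g::topological_space, 'b) monoid_scheme" (structure) +
  fixes expG :: "'v::euclidean_space \<Rightarrow> 'g"
    and s :: nat
    and V :: "nat \<Rightarrow> 'v set"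
  assumes homeo: "homeomorphism UNIV (carrier G) expG (logG expG)"
    and smooth_mult: "smooth_on UNIV (\<lambda>(x, y). logG expG (expG x \<otimes> expG y))"
    and one_parameter:
      "\<And>(a::real) b x. expG ((a + b) *\<^sub>R x) = expG (a *\<^sub>R x) \<otimes> expG (b *\<^sub>R x)"
    and layer_subspace: "\<And>j. j \<in> {1..s} \<Longrightarrow> subspace (V j)"
    and layer_direct_sum: "\<And>x. \<exists>!c. c \<in> (\<Pi>\<^sub>E j\<in>{1..s}. V j) \<and> x = (\<Sum>j=1..s. c j)"
    and layer_beyond: "V (s + 1) = {0}"
    and layer_bracket:
      "\<And>j. j \<in> {1..s} \<Longrightarrow> span {lie_bracket G expG x y |x y. x \<in> V 1 \<and> y \<in> V j} = V (j + 1)"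

locale normed_stratified_group = stratified_group G expG s V
  for G :: "('g::topological_space, 'b) monoid_scheme" (structure)
    and expG :: "'v::euclidean_space \<Rightarrow> 'g"
    and s :: nat
    and V :: "nat \<Rightarrow> 'v set" +
  fixes \<rho> :: "'g \<Rightarrow> real"
  assumes norm_nonneg: "\<And>g. g \<in> carrier G \<Longrightarrow> 0 \<le> \<rho> g"
    and norm_continuous: "continuous_on (carrier G) \<rho>"
    and norm_smooth: "smooth_on (UNIV - {0}) (\<lambda>x. \<rho> (expG x))"
    and norm_inv: "\<And>g. g \<in> carrier G \<Longrightarrow> \<rho> (inv g) = \<rho> g"
    and norm_triangle:
      "\<And>g h. g \<in> carrier G \<Longrightarrow> h \<in> carrier G \<Longrightarrow> \<rho> (inv g \<otimes> h) \<le> \<rho> g + \<rho> h"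
    and norm_dilation:
      "\<And>t g. 0 < t \<Longrightarrow> g \<in> carrier G \<Longrightarrow> \<rho> (dilation expG s V t g) = t * \<rho> g"
    and norm_eq_0_iff: "\<And>g. g \<in> carrier G \<Longrightarrow> \<rho> g = 0 \<longleftrightarrow> g = \<one>"

definition group_ball :: "('g, 'b) monoid_scheme \<Rightarrow> ('g \<Rightarrow> real) \<Rightarrow> 'g \<Rightarrow> real \<Rightarrow> 'g set" where
  "group_ball G \<rho> g r = {h \<in> carrier G. \<rho> (inv\<^bsub>G\<^esub> g \<otimes>\<^bsub>G\<^esub> h) < r}"


section \<open>The product of two stratified groups\<close>

text \<open>Haar measure on each factor is Lebesgue measure of the Lie algebra transferred by the
  exponential map.  The product measure is completed, so that measurable functions on the product
  are the Lebesgue measurable ones and not only the Borel ones.\<close>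

definition haar :: "('v::euclidean_space \<Rightarrow> 'g) \<Rightarrow> 'g measure" where
  "haar expG = embed_measure lborel expG"

definition prod_haar ::
  "('v::euclidean_space \<Rightarrow> 'g) \<Rightarrow> ('w::euclidean_space \<Rightarrow> 'h) \<Rightarrow> ('g \<times> 'h) measure" where
  "prod_haar exp1 exp2 = completion (haar exp1 \<Otimes>\<^sub>M haar exp2)"

definition strong_maximal ::
  "('g, 'b) monoid_scheme \<Rightarrow> ('v::euclidean_space \<Rightarrow> 'g) \<Rightarrow> ('g \<Rightarrow> real) \<Rightarrow>
   ('h, 'c) monoid_scheme \<Rightarrow> ('w::euclidean_space \<Rightarrow> 'h) \<Rightarrow> ('h \<Rightarrow> real) \<Rightarrow>
   ('g \<times> 'h \<Rightarrow> real) \<Rightarrow> 'g \<times> 'h \<Rightarrow> ennreal" where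
  "strong_maximal G1 exp1 \<rho>1 G2 exp2 \<rho>2 f g =
     (SUP P \<in> {group_ball G1 \<rho>1 x1 r1 \<times> group_ball G2 \<rho>2 x2 r2 |x1 r1 x2 r2.
                 x1 \<in> carrier G1 \<and> 0 < r1 \<and> x2 \<in> carrier G2 \<and> 0 < r2 \<and>
                 g \<in> group_ball G1 \<rho>1 x1 r1 \<times> group_ball G2 \<rho>2 x2 r2}.
        (\<integral>\<^sup>+ h \<in> P. ennreal \<bar>f h\<bar> \<partial>prod_haar exp1 exp2) / emeasure (prod_haar exp1 exp2) P)"

definition Phi :: "real \<Rightarrow> real" where
  "Phi s = s * ln (exp 1 + s)"

definition F_Phi ::
  "('v::euclidean_space \<Rightarrow> 'g) \<Rightarrow> ('w::euclidean_space \<Rightarrow> 'h) \<Rightarrow> ('g \<times> 'h \<Rightarrow> real) \<Rightarrow> ennreal" where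
  "F_Phi exp1 exp2 f = (\<integral>\<^sup>+ g. ennreal (Phi \<bar>f g\<bar>) \<partial>prod_haar exp1 exp2)"

text \<open>The infimum is taken in \<^typ>\<open>ennreal\<close>, so it is \<open>\<infinity>\<close> if no \<open>a\<close> qualifies.\<close>

definition luxemburg_norm ::
  "('v::euclidean_space \<Rightarrow> 'g) \<Rightarrow> ('w::euclidean_space \<Rightarrow> 'h) \<Rightarrow> ('g \<times> 'h \<Rightarrow> real) \<Rightarrow> ennreal" where
  "luxemburg_norm exp1 exp2 f =
     (INF a \<in> {a::real. 0 < a \<and> F_Phi exp1 exp2 (\<lambda>g. f g / a) \<le> 1}. ennreal a)"

definition L1_loc ::
  "('g::topological_space, 'b) monoid_scheme \<Rightarrow> ('v::euclidean_space \<Rightarrow> 'g) \<Rightarrow>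
   ('h::topological_space, 'c) monoid_scheme \<Rightarrow> ('w::euclidean_space \<Rightarrow> 'h) \<Rightarrow>
   ('g \<times> 'h \<Rightarrow> real) set" where
  "L1_loc G1 exp1 G2 exp2 =
     {f \<in> borel_measurable (prod_haar exp1 exp2).
        \<forall>K. compact K \<and> K \<subseteq> carrier G1 \<times> carrier G2 \<longrightarrow>
            set_integrable (prod_haar exp1 exp2) K f}"

definition L_log_L ::
  "('g::topological_space, 'b) monoid_scheme \<Rightarrow> ('v::euclidean_space \<Rightarrow> 'g) \<Rightarrow>
   ('h::topological_space, 'c) monoid_scheme \<Rightarrow> ('w::euclidean_space \<Rightarrow> 'h) \<Rightarrow>
   ('g \<times> 'h \<Rightarrow> real) set" where
  "L_log_L G1 exp1 G2 exp2 =
     {f \<in> L1_loc G1 exp1 G2 exp2. luxemburg_norm exp1 exp2 f < \<infinity>}"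

end

theory Submission
  imports Defs
begin

text \<open>The proof has a geometric half and an analytic half, which meet in the locale \<open>doubling_space\<close>.

Geometry: each factor, with its Haar measure and the left-invariant metric
\<open>\<rho> (inv g \<otimes> h)\<close>, is a doubling space (\<open>haar_doubling_space\<close>).  Balls about the identity are
dilates of each other and dilations are linear in the exponential chart, so these balls are doubling;
all other balls are left translates of them.  What has to be shown is that left translations preserve
Lebesgue measure in the chart, that is, that their Jacobian is 1.  By the cocycle property of Jacobians
it is enough to treat the derivative at the origin, whose inverse is the Maurer--Cartan form
\<open>mc_form x\<close>.  Differentiating $\exp(-tx)\exp(t(x+\varepsilon v))$ in \<open>\<epsilon>\<close> gives a curve
\<open>\<beta>\<close> with \<open>\<beta> 1 = mc_form x v\<close>, \<open>\<beta> 0 = 0\<close> and $\beta' = v - [x,\beta]$ (\<open>exp_var_ode\<close>).  The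
stratification makes the bracket push every step of the flag
\<open>flag j = V j \<oplus> V (j + 1) \<oplus> \<dots> \<oplus> V s\<close> into the next one, so the equation shows that \<open>mc_form x\<close>
is the identity on each quotient of consecutive steps (\<open>mc_form_unipotent\<close>).  Conjugating such a map with
dilations \<open>dil t\<close>, \<open>t \<rightarrow> 0\<close>, does not change its determinant and deforms it to the identity, so the
determinant is 1 (\<open>linear_det_unipotent\<close>).

Analysis: up to the doubling constants, an average over a product of balls is at most the maximal function
in the second variable of the maximal function in the first variable (\<open>rectangle_integral_le\<close>).  The
Vitali covering argument gives the weak type (1,1) inequality for each one-factor maximal function.  Used on
the second variable, in its version for the part of the function above half the level
(\<open>weak_type_truncated\<close>), it leaves the integral of the first maximal function over the set where it
exceeds that height.  That integral is at most a constant times the integral of \<open>f\<close> times the number of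
dyadic heights below \<open>f\<close> (\<open>llogl_dyadic\<close>), and this number is logarithmic in \<open>f\<close>
(\<open>dyadic_count_le_log\<close>), which is where \<open>\<Phi>\<close> comes from.

One-factor maximal functions are taken over countably many balls, with centres in a dense set and rational
radii; this makes all of them measurable and costs only a factor of the doubling constant.\<close>


section \<open>Determinants and change of variables on Euclidean spaces\<close>

text \<open>Determinants and the change of variables formula live on \<open>real ^ 'n\<close>.  With the basis of \<open>'v\<close> itself as
index type they are transported to \<open>'v\<close>, whatever its dimension is.\<close>
typedef (overloaded) ('v::euclidean_space) basis_index = "Basis :: 'v set"
  using nonempty_Basis by blast

instance basis_index :: (euclidean_space) finite
proof
  have "(UNIV :: 'a basis_index set) = Abs_basis_index ` Basis"
    using type_definition.Abs_image[OF type_definition_basis_index] by metis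
  then show "finite (UNIV :: 'a basis_index set)"
    using finite_Basis finite_imageI by metis
qed

text \<open>The order of the index type is arbitrary; it is pulled back from an enumeration.\<close>
definition basis_rank :: "'v::euclidean_space basis_index \<Rightarrow> nat" where
  "basis_rank = (SOME f. inj f)"

lemma inj_basis_rank: "inj (basis_rank :: 'v::euclidean_space basis_index \<Rightarrow> nat)"
proof -
  have "\<exists>f :: 'v basis_index \<Rightarrow> nat. inj f"
    using finite_imp_inj_to_nat_seg[of "UNIV :: 'v basis_index set"] by auto
  then show ?thesis unfolding basis_rank_def by (rule someI_ex)
qed

instantiation basis_index :: (euclidean_space) wellorder
begin
definition "less_eq_basis_index (a :: 'a basis_index) (b :: 'a basis_index) \<longleftrightarrow> basis_rank a \<le> basis_rank b"
definition "less_basis_index (a :: 'a basis_index) (b :: 'a basis_index) \<longleftrightarrow> basis_rank a < basis_rank b"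
instance
proof
  fix P :: "'a basis_index \<Rightarrow> bool" and a :: "'a basis_index"
  assume "\<And>x. (\<And>y. y < x \<Longrightarrow> P y) \<Longrightarrow> P x"
  then show "P a"
    unfolding less_basis_index_def by (rule measure_induct_rule)
qed (auto simp: less_eq_basis_index_def less_basis_index_def dest: injD[OF inj_basis_rank])
end

lemma bij_Rep_basis_index: "bij_betw Rep_basis_index UNIV (Basis :: 'v::euclidean_space set)"
  using Rep_basis_index_inject Rep_basis_index type_definition.Rep_range[OF type_definition_basis_index]
  by (auto simp: bij_betw_def inj_def)

lemma ball_Basis_iff: "(\<forall>b\<in>(Basis :: 'v::euclidean_space set). P b) \<longleftrightarrow> (\<forall>i. P (Rep_basis_index i))"
  unfolding bij_betw_imp_surj_on[OF bij_Rep_basis_index, symmetric] by auto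

definition coords :: "'v::euclidean_space \<Rightarrow> real ^ 'v basis_index" where
  "coords x = (\<chi> i. x \<bullet> Rep_basis_index i)"

definition uncoords :: "real ^ 'v basis_index \<Rightarrow> 'v::euclidean_space" where
  "uncoords y = (\<Sum>i\<in>UNIV. y $ i *\<^sub>R Rep_basis_index i)"

lemma uncoords_coords [simp]: "uncoords (coords x) = x"
proof -
  have "uncoords (coords x) = (\<Sum>b\<in>Basis. (x \<bullet> b) *\<^sub>R b)"
    using sum.reindex_bij_betw[OF bij_Rep_basis_index, of "\<lambda>b. (x \<bullet> b) *\<^sub>R b"]
    unfolding uncoords_def coords_def by simp
  then show ?thesis by (simp add: euclidean_representation)
qed

lemma inner_Rep_basis_index:
  "Rep_basis_index i \<bullet> Rep_basis_index j = (if i = j then 1 else 0)"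
  using inner_Basis[OF Rep_basis_index Rep_basis_index, of i j] by (simp add: Rep_basis_index_inject)

lemma coords_uncoords [simp]: "coords (uncoords y) = y"
  by (simp add: vec_eq_iff coords_def uncoords_def inner_sum_left inner_Rep_basis_index
      if_distrib[of "\<lambda>a. _ * a"] cong: if_cong)

lemma linear_coords: "linear coords"
  by (rule linearI) (auto simp: coords_def vec_eq_iff inner_add_left)

lemma linear_uncoords: "linear uncoords"
  by (rule linearI)
    (auto simp: uncoords_def scaleR_add_left sum.distrib scaleR_sum_right)

lemma inj_coords: "inj coords"
  by (metis injI uncoords_coords)

lemma inj_uncoords: "inj uncoords"
  by (metis injI coords_uncoords)

lemma coords_image_eq_vimage: "coords ` S = uncoords -` S"
  using coords_uncoords by (force simp: image_iff)

lemma borel_measurable_coords [measurable]: "coords \<in> borel_measurable borel"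
  using linear_coords by (intro borel_measurable_continuous_onI linear_continuous_on)
    (simp add: linear_conv_bounded_linear)

lemma borel_measurable_uncoords [measurable]: "uncoords \<in> borel_measurable borel"
  using linear_uncoords by (intro borel_measurable_continuous_onI linear_continuous_on)
    (simp add: linear_conv_bounded_linear)

lemma distr_coords: "distr lborel borel coords = (lborel :: (real ^ 'v::euclidean_space basis_index) measure)"
proof (rule lborel_eqI[symmetric])
  fix l u :: "real ^ 'v basis_index"
  assume le: "\<And>b. b \<in> Basis \<Longrightarrow> l \<bullet> b \<le> u \<bullet> b"
  have bij: "bij_betw (\<lambda>i. axis i (1::real)) UNIV (Basis :: (real ^ 'v basis_index) set)"
    by (auto simp: bij_betw_def inj_def axis_eq_axis Basis_vec_def)
  have inner: "uncoords y \<bullet> Rep_basis_index i = y $ i" for i and y :: "real ^ 'v basis_index"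
    using coords_uncoords[of y] unfolding coords_def vec_eq_iff by simp
  have lei: "l $ i \<le> u $ i" for i
    using le[of "axis i 1"] by (simp add: inner_axis)
  have "coords -` box l u = box (uncoords l) (uncoords u)"
    by (auto simp: mem_box_cart mem_box ball_Basis_iff coords_def inner)
  then have "emeasure (distr lborel borel coords) (box l u) = emeasure lborel (box (uncoords l) (uncoords u))"
    by (simp add: emeasure_distr)
  also have "\<dots> = (\<Prod>b\<in>Basis. (uncoords u - uncoords l) \<bullet> b)"
    using lei ball_Basis_iff[of "\<lambda>b. uncoords l \<bullet> b \<le> uncoords u \<bullet> b"]
    by (subst emeasure_lborel_box) (simp_all add: inner)
  also have "(\<Prod>b\<in>Basis. (uncoords u - uncoords l) \<bullet> b) = (\<Prod>i\<in>UNIV. u $ i - l $ i)"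
    by (simp add: prod.reindex_bij_betw[OF bij_Rep_basis_index, symmetric] inner inner_diff_left)
  also have "\<dots> = (\<Prod>b\<in>Basis. (u - l) \<bullet> b)"
    by (simp add: prod.reindex_bij_betw[OF bij, symmetric] inner_axis)
  finally show "emeasure (distr lborel borel coords) (box l u) = (\<Prod>b\<in>Basis. (u - l) \<bullet> b)" .
qed simp

lemma emeasure_coords_image:
  assumes "S \<in> sets borel"
  shows "coords ` S \<in> sets borel" "emeasure lborel (coords ` S) = emeasure lborel S"
proof -
  show B: "coords ` S \<in> sets borel"
    unfolding coords_image_eq_vimage using measurable_sets_borel[OF borel_measurable_uncoords assms] by simp
  have "emeasure lborel (coords ` S) = emeasure lborel (coords -` coords ` S)"
    using B by (subst distr_coords[symmetric]) (simp add: emeasure_distr)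
  then show "emeasure lborel (coords ` S) = emeasure lborel S"
    by (simp add: inj_vimage_image_eq inj_coords)
qed

text \<open>The determinant of a linear endomorphism, read off in the orthonormal basis \<open>Basis\<close>.\<close>
definition linear_det :: "('v \<Rightarrow> 'v::euclidean_space) \<Rightarrow> real" where
  "linear_det f = det (matrix (coords \<circ> f \<circ> uncoords))"

lemma linear_det_id: "linear_det (\<lambda>x :: 'v::euclidean_space. x) = 1"
proof -
  have "coords \<circ> (\<lambda>x. x) \<circ> uncoords = (id :: real ^ 'v basis_index \<Rightarrow> _)"
    by (auto simp: fun_eq_iff)
  then show ?thesis unfolding linear_det_def by (simp only: matrix_id_mat_1 det_I)
qed

lemma linear_det_compose:
  fixes f g :: "'v::euclidean_space \<Rightarrow> 'v"
  assumes "linear f" "linear g"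
  shows "linear_det (\<lambda>x. f (g x)) = linear_det f * linear_det g"
proof -
  have eq: "coords \<circ> (\<lambda>x. f (g x)) \<circ> uncoords = (coords \<circ> f \<circ> uncoords) \<circ> (coords \<circ> g \<circ> uncoords)"
    by (auto simp: fun_eq_iff)
  have "linear (coords \<circ> f \<circ> uncoords)" "linear (coords \<circ> g \<circ> uncoords)"
    using assms by (intro linear_compose linear_coords linear_uncoords; simp)+
  then show ?thesis
    unfolding linear_det_def eq by (simp add: matrix_compose det_mul)
qed

lemma tendsto_linear_det_id:
  fixes f :: "'t \<Rightarrow> 'a::euclidean_space \<Rightarrow> 'a"
  assumes "\<And>v. ((\<lambda>t. f t v) \<longlongrightarrow> v) F"
  shows "((\<lambda>t. linear_det (f t)) \<longlongrightarrow> 1) F"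
proof -
  have ent: "((\<lambda>t. matrix (coords \<circ> f t \<circ> uncoords) $ i $ j) \<longlongrightarrow> (mat 1 :: real^_^_) $ i $ j) F" for i j
  proof -
    have "((\<lambda>t. coords (f t (uncoords (axis j 1))) $ i) \<longlongrightarrow> coords (uncoords (axis j 1)) $ i) F"
      unfolding coords_def by (simp add: tendsto_inner assms)
    then show ?thesis
      by (simp add: matrix_def mat_def axis_def eq_commute[of j i])
  qed
  have "((\<lambda>t. linear_det (f t)) \<longlongrightarrow> det (mat 1 :: real ^ 'a basis_index ^ 'a basis_index)) F"
    unfolding linear_det_def det_def by (intro tendsto_sum tendsto_mult tendsto_prod tendsto_const ent)
  then show ?thesis by simp
qed

text \<open>The change of variables formula for a constant Jacobian.  It is applied to left translations (\<open>c = 1\<close>)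
and to dilations.\<close>
lemma emeasure_image_constant_jacobian:
  fixes f :: "'v::euclidean_space \<Rightarrow> 'v"
  assumes S: "S \<in> sets borel" "emeasure lborel S < \<infinity>" "f ` S \<in> sets borel"
    and inj: "inj f"
    and deriv: "\<And>x. (f has_derivative f' x) (at x)"
    and jac: "\<And>x. \<bar>linear_det (f' x)\<bar> = c"
  shows "emeasure lborel (f ` S) = ennreal c * emeasure lborel S"
proof -
  define g where "g = coords \<circ> f \<circ> uncoords"
  define T where "T = coords ` S"
  have gT: "g ` T = coords ` (f ` S)" by (simp add: g_def T_def image_image)
  have T: "T \<in> sets borel" "emeasure lborel T = emeasure lborel S"
    unfolding T_def using emeasure_coords_image[OF S(1)] by simp_all
  have gTm: "g ` T \<in> sets borel" "emeasure lborel (g ` T) = emeasure lborel (f ` S)"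
    unfolding gT using emeasure_coords_image[OF S(3)] by simp_all
  have dg: "(g has_derivative (coords \<circ> f' (uncoords y) \<circ> uncoords)) (at y within T)" for y
  proof -
    have "(uncoords has_derivative uncoords) (at y)" "(coords has_derivative coords) (at (f (uncoords y)))"
      using linear_uncoords linear_coords
      by (auto intro!: bounded_linear_imp_has_derivative simp: linear_conv_bounded_linear[symmetric])
    then have "(g has_derivative (coords \<circ> f' (uncoords y) \<circ> uncoords)) (at y)"
      unfolding g_def using deriv by (intro diff_chain_at) auto
    then show ?thesis by (rule has_derivative_at_withinI)
  qed
  have leb: "emeasure lebesgue A = emeasure lborel A" if "A \<in> sets borel" for A :: "(real ^ 'v basis_index) set"
    using that by simp
  have T_lm: "T \<in> lmeasurable"
    using T S(2) by (intro fmeasurableI) (simp_all add: leb)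
  have hc: "((\<lambda>y. \<bar>det (matrix (coords \<circ> f' (uncoords y) \<circ> uncoords))\<bar>) has_integral (c * measure lebesgue T)) T"
    using has_integral_mult_right[OF integrable_integral[OF lmeasurable_iff_integrable_on[THEN iffD1, OF T_lm]], of c]
      lmeasure_integral[OF T_lm] jac
    unfolding linear_det_def by simp
  have "inj g"
    unfolding g_def by (intro inj_compose inj_coords inj_uncoords inj)
  then have "inj_on g T"
    by (rule inj_on_subset) simp
  then have "g ` T \<in> lmeasurable" "measure lebesgue (g ` T) = c * measure lebesgue T"
    using has_measure_differentiable_image[of T g "\<lambda>y. coords \<circ> f' (uncoords y) \<circ> uncoords" "c * measure lebesgue T"]
      hc T(1) dg by simp_all
  moreover have "0 \<le> c" using jac[of undefined] by (metis abs_ge_zero)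
  ultimately have "emeasure lebesgue (g ` T) = ennreal c * emeasure lebesgue T"
    using T_lm by (simp only: emeasure_eq_measure2 ennreal_mult')
  then show ?thesis
    using T gTm leb by simp
qed

section \<open>Lie groups in exponential coordinates\<close>

lemma has_vector_derivative_at_0_iff:
  fixes f :: "real \<Rightarrow> 'a::real_normed_vector"
  assumes "f 0 = 0"
  shows "(f has_vector_derivative D) (at 0) \<longleftrightarrow> ((\<lambda>h. inverse h *\<^sub>R f h) \<longlongrightarrow> D) (at 0)"
proof -
  have "norm (f h - h *\<^sub>R D) / norm h = norm (inverse h *\<^sub>R f h - D)" if "h \<noteq> 0" for h
  proof -
    have "inverse h *\<^sub>R f h - D = inverse h *\<^sub>R (f h - h *\<^sub>R D)"
      using that by (simp add: scaleR_diff_right)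
    then show ?thesis by (simp add: divide_inverse mult.commute)
  qed
  then have ev: "\<forall>\<^sub>F h in at 0. norm (f h - h *\<^sub>R D) / norm h = norm (inverse h *\<^sub>R f h - D)"
    by (simp add: eventually_at_filter)
  have "(f has_vector_derivative D) (at 0) \<longleftrightarrow> ((\<lambda>h. norm (f h - h *\<^sub>R D) / norm h) \<longlongrightarrow> 0) (at 0)"
    unfolding has_vector_derivative_def has_derivative_at
    using assms by (simp add: bounded_linear_scaleR_left)
  also have "\<dots> \<longleftrightarrow> ((\<lambda>h. norm (inverse h *\<^sub>R f h - D)) \<longlongrightarrow> 0) (at 0)"
    by (rule tendsto_cong[OF ev])
  also have "\<dots> \<longleftrightarrow> ((\<lambda>h. inverse h *\<^sub>R f h) \<longlongrightarrow> D) (at 0)"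
    by (simp add: tendsto_norm_zero_iff LIM_zero_iff)
  finally show ?thesis .
qed

text \<open>Every linear functional that vanishes on \<open>W\<close> is constant along \<open>f\<close>.  This replaces solving the
differential equation of \<open>exp_var\<close> explicitly.\<close>
lemma in_subspace_if_derivative_in:
  fixes f :: "real \<Rightarrow> 'a::euclidean_space"
  assumes W: "subspace W" and 0: "f 0 \<in> W"
    and deriv: "\<And>t. (f has_vector_derivative f' t) (at t)" and in_W: "\<And>t. f' t \<in> W"
  shows "f t \<in> W"
proof -
  obtain y z where yz: "y \<in> span W" "\<And>w. w \<in> span W \<Longrightarrow> orthogonal z w" "f t = y + z"
    using orthogonal_subspace_decomp_exists[of W "f t"] by blast
  have orth: "z \<bullet> w = 0" if "w \<in> W" for w
    using yz(2)[OF span_base[OF that]] by (simp add: orthogonal_def)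
  have "((\<lambda>t. z \<bullet> f t) has_vector_derivative z \<bullet> f' u) (at u)" for u
    by (rule bounded_linear.has_vector_derivative[OF bounded_linear_inner_right deriv])
  then have "((\<lambda>t. z \<bullet> f t) has_vector_derivative 0) (at u)" for u
    using orth[OF in_W] by simp
  then obtain c where "\<And>u. u \<in> UNIV \<Longrightarrow> z \<bullet> f u = c"
    using has_vector_derivative_zero_constant[OF convex_UNIV, of "\<lambda>t. z \<bullet> f t"] by blast
  then have "z \<bullet> f t = z \<bullet> f 0" by simp
  then have "z \<bullet> (y + z) = 0" using orth[OF 0] yz(3) by simp
  moreover have "z \<bullet> y = 0" using yz(1) orth W by (simp add: span_eq_iff[THEN iffD2])
  ultimately have "z = 0" by (simp add: inner_add_right)
  then show ?thesis using yz(1,3) W by (simp add: span_eq_iff[THEN iffD2])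
qed

text \<open>A Lie group law on \<open>'v\<close> in exponential coordinates, with derivative \<open>m'\<close>: lines through \<open>0\<close> are
one-parameter subgroups, so \<open>0\<close> is the identity and \<open>- x\<close> the inverse of \<open>x\<close>.\<close>
locale chart_group =
  fixes m :: "'v::euclidean_space \<Rightarrow> 'v \<Rightarrow> 'v" and m' :: "'v \<times> 'v \<Rightarrow> 'v \<times> 'v \<Rightarrow> 'v"
  assumes assoc: "m (m x y) z = m x (m y z)"
    and one_param: "m (a *\<^sub>R x) (b *\<^sub>R x) = (a + b) *\<^sub>R x"
    and deriv: "((\<lambda>(x, y). m x y) has_derivative m' p) (at p)"
    and deriv_continuous: "continuous_on UNIV (\<lambda>p. m' p v)"
begin

lemma m_0_left [simp]: "m 0 x = x" and m_0_right [simp]: "m x 0 = x"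
  and m_minus_left [simp]: "m (- x) x = 0" and m_minus_right [simp]: "m x (- x) = 0"
  using one_param[of 0 x 1] one_param[of 1 x 0] one_param[of "-1" x 1] one_param[of 1 x "-1"] by auto

lemma m_cancel [simp]: "m (- x) (m x y) = y" and m_cancel' [simp]: "m x (m (- x) y) = y"
  by (simp_all add: assoc[symmetric])

lemma minus_m: "- m x y = m (- y) (- x)"
proof -
  have "m (- m x y) (m (m x y) (m (- y) (- x))) = m (- y) (- x)" by (rule m_cancel)
  moreover have "m (m x y) (m (- y) (- x)) = 0" by (simp add: assoc)
  ultimately show ?thesis by simp
qed

lemma linear_deriv: "linear (m' p)"
  using deriv by (rule has_derivative_linear)

lemma has_derivative_m:
  assumes "(f has_derivative f') (at x within S)" "(g has_derivative g') (at x within S)"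
  shows "((\<lambda>t. m (f t) (g t)) has_derivative (\<lambda>h. m' (f x, g x) (f' h, g' h))) (at x within S)"
  using has_derivative_compose[OF has_derivative_Pair[OF assms] deriv] by simp

lemma has_vector_derivative_m:
  assumes "(f has_vector_derivative f') (at t)" "(g has_vector_derivative g') (at t)"
  shows "((\<lambda>t. m (f t) (g t)) has_vector_derivative m' (f t, g t) (f', g')) (at t)"
proof -
  have "m' (f t, g t) (h *\<^sub>R f', h *\<^sub>R g') = h *\<^sub>R m' (f t, g t) (f', g')" for h
    using linear_cmul[OF linear_deriv, of _ h "(f', g')"] by simp
  then show ?thesis
    using has_derivative_m[OF assms[unfolded has_vector_derivative_def]]
    unfolding has_vector_derivative_def by simp
qed

lemma has_vector_derivative_line: "((\<lambda>t. t *\<^sub>R x) has_vector_derivative x) (at t)"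
  using bounded_linear.has_vector_derivative[OF bounded_linear_scaleR_left has_vector_derivative_id] by simp

lemma m'_0_left: "m' (0, b) (0, w) = w"
proof -
  have "((\<lambda>t. m 0 (b + t *\<^sub>R w)) has_vector_derivative m' (0, b + 0 *\<^sub>R w) (0, 0 + w)) (at 0)"
    by (intro has_vector_derivative_m has_vector_derivative_add has_vector_derivative_const has_vector_derivative_line)
  then have "((\<lambda>t. b + t *\<^sub>R w) has_vector_derivative m' (0, b) (0, w)) (at 0)" by simp
  moreover have "((\<lambda>t. b + t *\<^sub>R w) has_vector_derivative 0 + w) (at 0)"
    by (intro has_vector_derivative_add has_vector_derivative_const has_vector_derivative_line)
  ultimately have "m' (0, b) (0, w) = 0 + w" by (rule vector_derivative_unique_at)
  then show ?thesis by simp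
qed

lemma m'_0_right: "m' (b, 0) (w, 0) = w"
proof -
  have "((\<lambda>t. m (b + t *\<^sub>R w) 0) has_vector_derivative m' (b + 0 *\<^sub>R w, 0) (0 + w, 0)) (at 0)"
    by (intro has_vector_derivative_m has_vector_derivative_add has_vector_derivative_const has_vector_derivative_line)
  then have "((\<lambda>t. b + t *\<^sub>R w) has_vector_derivative m' (b, 0) (w, 0)) (at 0)" by simp
  moreover have "((\<lambda>t. b + t *\<^sub>R w) has_vector_derivative 0 + w) (at 0)"
    by (intro has_vector_derivative_add has_vector_derivative_const has_vector_derivative_line)
  ultimately have "m' (b, 0) (w, 0) = 0 + w" by (rule vector_derivative_unique_at)
  then show ?thesis by simp
qed

lemma m'_0: "m' (0, 0) (u, w) = u + w"
  using linear_add[OF linear_deriv, of "(0, 0)" "(u, 0)" "(0, w)"] by (simp add: m'_0_left m'_0_right)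

text \<open>Conjugation in the chart; it is the adjoint representation because it turns out to be linear.\<close>
definition Ad :: "'v \<Rightarrow> 'v \<Rightarrow> 'v" where
  "Ad x y = m (m x y) (- x)"

lemma Ad_0_right [simp]: "Ad x 0 = 0" and Ad_0_left [simp]: "Ad 0 y = y"
  by (simp_all add: Ad_def)

lemma Ad_m: "Ad x (m y z) = m (Ad x y) (Ad x z)"
  by (simp add: Ad_def assoc)

lemma Ad_Ad: "Ad x (Ad y z) = Ad (m x y) z"
  by (simp add: Ad_def assoc minus_m)

lemma Ad_of_nat: "Ad x (real n *\<^sub>R y) = real n *\<^sub>R Ad x y"
proof (induction n)
  case (Suc n)
  have "Ad x (real (Suc n) *\<^sub>R y) = Ad x (m (real n *\<^sub>R y) (1 *\<^sub>R y))"
    unfolding one_param by (simp add: add.commute)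
  also have "\<dots> = m (real n *\<^sub>R Ad x y) (1 *\<^sub>R Ad x y)"
    by (simp add: Ad_m Suc)
  also have "\<dots> = real (Suc n) *\<^sub>R Ad x y"
    unfolding one_param by (simp add: add.commute)
  finally show ?case .
qed simp

text \<open>Conjugation is an automorphism and hence homogeneous under multiplication by natural numbers.  A map that is
differentiable at \<open>0\<close> with \<open>Ad x y = n *\<^sub>R Ad x (y / n)\<close> for all \<open>n\<close> equals its derivative there.\<close>
lemma linear_Ad: "linear (Ad x)"
proof -
  define L where "L h = m' (m x 0, - x) (m' (x, 0) (0, h), 0)" for h
  have L: "(Ad x has_derivative L) (at 0)"
    unfolding Ad_def L_def by (intro has_derivative_m has_derivative_const has_derivative_ident)
  have "Ad x y = L y" for y
  proof -
    have "((\<lambda>t. Ad x (t *\<^sub>R y)) has_derivative (\<lambda>t. L (t *\<^sub>R y))) (at 0)"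
      using has_derivative_compose[of "\<lambda>t. t *\<^sub>R y" "\<lambda>t. t *\<^sub>R y" 0 UNIV "Ad x" L] L
      by (simp add: bounded_linear_imp_has_derivative bounded_linear_scaleR_left)
    then have "((\<lambda>t. Ad x (t *\<^sub>R y)) has_vector_derivative L y) (at 0)"
      using linear_cmul[OF has_derivative_linear[OF L]] by (simp add: has_vector_derivative_def)
    then have lim: "((\<lambda>t. inverse t *\<^sub>R Ad x (t *\<^sub>R y)) \<longlongrightarrow> L y) (at 0)"
      by (subst (asm) has_vector_derivative_at_0_iff) simp_all
    have "filterlim (\<lambda>n. inverse (real (Suc n))) (at 0) sequentially"
      using LIMSEQ_inverse_real_of_nat by (simp add: filterlim_at)
    from filterlim_compose[OF lim this]
    have "(\<lambda>n. real (Suc n) *\<^sub>R Ad x (inverse (real (Suc n)) *\<^sub>R y)) \<longlonglongrightarrow> L y"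
      by simp
    moreover have "real (Suc n) *\<^sub>R Ad x (inverse (real (Suc n)) *\<^sub>R y) = Ad x y" for n
      using Ad_of_nat[of x "Suc n" "inverse (real (Suc n)) *\<^sub>R y"] by simp
    ultimately have "(\<lambda>n::nat. Ad x y) \<longlonglongrightarrow> L y" by simp
    then show ?thesis by (simp add: LIMSEQ_const_iff)
  qed
  then have "Ad x = L" by auto
  then show ?thesis using has_derivative_linear[OF L] by simp
qed

text \<open>The derivative of \<open>z \<mapsto> Ad z y\<close> at \<open>0\<close> in the direction \<open>x\<close>, written out with the chain rule.\<close>
definition bracket :: "'v \<Rightarrow> 'v \<Rightarrow> 'v" where
  "bracket x y = m' (y, 0) (m' (0, y) (x, 0), - x)"

lemma has_derivative_Ad: "((\<lambda>z. Ad z y) has_derivative (\<lambda>x. bracket x y)) (at 0)"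
proof -
  have "((\<lambda>z. m (m z y) (- z)) has_derivative (\<lambda>h. m' (m 0 y, - 0) (m' (0, y) (h, 0), - h))) (at 0)"
    by (intro has_derivative_m has_derivative_const has_derivative_ident has_derivative_minus)
  then show ?thesis by (simp add: Ad_def bracket_def)
qed

lemma has_vector_derivative_Ad: "((\<lambda>t. Ad (t *\<^sub>R x) y) has_vector_derivative bracket x y) (at 0)"
proof -
  have "((\<lambda>t. Ad (t *\<^sub>R x) y) has_derivative (\<lambda>t. bracket (t *\<^sub>R x) y)) (at 0)"
    using has_derivative_compose[of "\<lambda>t. t *\<^sub>R x" "\<lambda>t. t *\<^sub>R x" 0 UNIV "\<lambda>z. Ad z y" "\<lambda>x. bracket x y"]
      has_derivative_Ad
    by (simp add: bounded_linear_imp_has_derivative bounded_linear_scaleR_left)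
  then show ?thesis
    using linear_cmul[OF has_derivative_linear[OF has_derivative_Ad]] by (simp add: has_vector_derivative_def)
qed

lemma bilinear_bracket: "bilinear bracket"
proof -
  have "linear (bracket x)" for x
  proof (rule linearI)
    fix y z :: 'v and c :: real
    have "((\<lambda>t. Ad (t *\<^sub>R x) (y + z)) has_vector_derivative bracket x y + bracket x z) (at 0)"
      unfolding linear_add[OF linear_Ad] by (intro has_vector_derivative_add has_vector_derivative_Ad)
    then show "bracket x (y + z) = bracket x y + bracket x z"
      by (rule vector_derivative_unique_at[OF has_vector_derivative_Ad])
    have "((\<lambda>t. Ad (t *\<^sub>R x) (c *\<^sub>R y)) has_vector_derivative c *\<^sub>R bracket x y) (at 0)"
      unfolding linear_cmul[OF linear_Ad]
      by (intro bounded_linear.has_vector_derivative[OF bounded_linear_scaleR_right] has_vector_derivative_Ad)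
    then show "bracket x (c *\<^sub>R y) = c *\<^sub>R bracket x y"
      by (rule vector_derivative_unique_at[OF has_vector_derivative_Ad])
  qed
  then show ?thesis
    unfolding bilinear_def using has_derivative_linear[OF has_derivative_Ad] by blast
qed

text \<open>Conjugation carries the curve \<open>t \<mapsto> Ad (t *\<^sub>R x) y\<close>, whose velocity is the bracket, to the corresponding
curve of the conjugated vectors.\<close>
lemma Ad_bracket: "Ad z (bracket x y) = bracket (Ad z x) (Ad z y)"
proof -
  have "((\<lambda>t. Ad z (Ad (t *\<^sub>R x) y)) has_vector_derivative Ad z (bracket x y)) (at 0)"
    by (rule bounded_linear.has_vector_derivative[OF _ has_vector_derivative_Ad])
      (use linear_Ad in \<open>simp add: linear_conv_bounded_linear\<close>)
  moreover have "Ad z (Ad w y) = Ad (Ad z w) (Ad z y)" for w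
  proof -
    have "m (Ad z w) z = m z w" by (simp add: Ad_def assoc)
    then show ?thesis by (simp add: Ad_Ad)
  qed
  ultimately have "((\<lambda>t. Ad (t *\<^sub>R Ad z x) (Ad z y)) has_vector_derivative Ad z (bracket x y)) (at 0)"
    by (simp add: linear_cmul[OF linear_Ad])
  then show ?thesis by (rule vector_derivative_unique_at[OF _ has_vector_derivative_Ad])
qed

text \<open>The derivative of \<open>Ad_bracket\<close> at \<open>z = 0\<close>.\<close>
lemma jacobi: "bracket z (bracket x y) = bracket (bracket z x) y + bracket x (bracket z y)"
proof -
  have bb: "bounded_bilinear bracket" using bilinear_bracket by (simp add: bilinear_conv_bounded_bilinear)
  have "((\<lambda>t. bracket (Ad (t *\<^sub>R z) x) (Ad (t *\<^sub>R z) y)) has_vector_derivative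
      bracket (Ad (0 *\<^sub>R z) x) (bracket z y) + bracket (bracket z x) (Ad (0 *\<^sub>R z) y)) (at 0)"
    by (intro bounded_bilinear.has_vector_derivative[OF bb] has_vector_derivative_Ad)
  then have "((\<lambda>t. Ad (t *\<^sub>R z) (bracket x y)) has_vector_derivative bracket x (bracket z y) + bracket (bracket z x) y) (at 0)"
    by (simp add: Ad_bracket)
  from vector_derivative_unique_at[OF has_vector_derivative_Ad this] show ?thesis by simp
qed

text \<open>The left Maurer--Cartan form: the derivative at \<open>x\<close> of the left translation by \<open>- x\<close>.\<close>
definition mc_form :: "'v \<Rightarrow> 'v \<Rightarrow> 'v" where
  "mc_form x v = m' (- x, x) (0, v)"

text \<open>The variation of the exponential map, that is, the derivative at \<open>\<epsilon> = 0\<close> of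
$\exp(-tx)\exp(t(x+\varepsilon v))$; see \<open>exp_var_eq\<close>.\<close>
definition exp_var :: "'v \<Rightarrow> 'v \<Rightarrow> real \<Rightarrow> 'v" where
  "exp_var x v t = t *\<^sub>R mc_form (t *\<^sub>R x) v"

lemma linear_mc_form: "linear (mc_form x)"
proof (rule linearI)
  show "mc_form x (v + w) = mc_form x v + mc_form x w" for v w
    unfolding mc_form_def using linear_add[OF linear_deriv, of "(-x, x)" "(0, v)" "(0, w)"] by simp
  show "mc_form x (c *\<^sub>R v) = c *\<^sub>R mc_form x v" for c v
    unfolding mc_form_def using linear_cmul[OF linear_deriv, of "(-x, x)" c "(0, v)"] by simp
qed

lemma exp_var_eq:
  "((\<lambda>e. m (- (t *\<^sub>R x)) (t *\<^sub>R (x + e *\<^sub>R v))) has_vector_derivative exp_var x v t) (at 0)"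
proof -
  have "((\<lambda>e. t *\<^sub>R (x + e *\<^sub>R v)) has_vector_derivative t *\<^sub>R (0 + v)) (at 0)"
    by (intro bounded_linear.has_vector_derivative[OF bounded_linear_scaleR_right]
        has_vector_derivative_add has_vector_derivative_const has_vector_derivative_line)
  from has_vector_derivative_m[OF has_vector_derivative_const this, of "- (t *\<^sub>R x)"]
  have "((\<lambda>e. m (- (t *\<^sub>R x)) (t *\<^sub>R (x + e *\<^sub>R v))) has_vector_derivative mc_form (t *\<^sub>R x) (t *\<^sub>R v)) (at 0)"
    by (simp add: mc_form_def)
  then show ?thesis by (simp add: exp_var_def linear_cmul[OF linear_mc_form])
qed

text \<open>Group the factors of the varied product as
$\exp(-hx)\,[\exp(-tx)\exp(t(x+\varepsilon v))]\,\exp(hx)\cdot\exp(-hx)\exp(h(x+\varepsilon v))$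
and differentiate; at the identity the derivative of a product is the sum of the derivatives.\<close>
lemma exp_var_add: "exp_var x v (t + h) = Ad (- (h *\<^sub>R x)) (exp_var x v t) + exp_var x v h"
proof -
  define \<phi> where "\<phi> t e = m (- (t *\<^sub>R x)) (t *\<^sub>R (x + e *\<^sub>R v))" for t e
  have d: "(\<phi> t has_vector_derivative exp_var x v t) (at 0)" for t
    unfolding \<phi>_def[abs_def] by (rule exp_var_eq)
  have \<phi>_0: "\<phi> t 0 = 0" for t by (simp add: \<phi>_def)
  have "\<phi> (t + h) = (\<lambda>e. m (Ad (- (h *\<^sub>R x)) (\<phi> t e)) (\<phi> h e))"
  proof
    fix e
    have "- ((t + h) *\<^sub>R x) = m (- (h *\<^sub>R x)) (- (t *\<^sub>R x))"
      using one_param[of "- h" x "- t"] by (simp add: algebra_simps)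
    moreover have "(t + h) *\<^sub>R (x + e *\<^sub>R v) = m (t *\<^sub>R (x + e *\<^sub>R v)) (h *\<^sub>R (x + e *\<^sub>R v))"
      by (rule one_param[symmetric])
    ultimately show "\<phi> (t + h) e = m (Ad (- (h *\<^sub>R x)) (\<phi> t e)) (\<phi> h e)"
      by (simp only: \<phi>_def Ad_def assoc minus_minus m_cancel')
  qed
  moreover have "((\<lambda>e. m (Ad (- (h *\<^sub>R x)) (\<phi> t e)) (\<phi> h e)) has_vector_derivative
      m' (Ad (- (h *\<^sub>R x)) (\<phi> t 0), \<phi> h 0) (Ad (- (h *\<^sub>R x)) (exp_var x v t), exp_var x v h)) (at 0)"
    using linear_Ad
    by (intro has_vector_derivative_m d bounded_linear.has_vector_derivative[OF _ d])
      (simp add: linear_conv_bounded_linear)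
  ultimately have "(\<phi> (t + h) has_vector_derivative
      Ad (- (h *\<^sub>R x)) (exp_var x v t) + exp_var x v h) (at 0)"
    by (simp add: \<phi>_0 m'_0)
  from vector_derivative_unique_at[OF d this] show ?thesis .
qed

lemma exp_var_derivative_0: "(exp_var x v has_vector_derivative v) (at 0)"
proof -
  have "continuous_on UNIV (\<lambda>h. m' (- (h *\<^sub>R x), h *\<^sub>R x) (0, v))"
    by (intro continuous_on_compose2[OF deriv_continuous] continuous_intros) auto
  then have "((\<lambda>h. m' (- (h *\<^sub>R x), h *\<^sub>R x) (0, v)) \<longlongrightarrow> m' (- (0 *\<^sub>R x), 0 *\<^sub>R x) (0, v)) (at 0)"
    unfolding continuous_on_def by blast
  then have "((\<lambda>h. mc_form (h *\<^sub>R x) v) \<longlongrightarrow> v) (at 0)"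
    by (simp add: mc_form_def m'_0)
  moreover have "\<forall>\<^sub>F h in at 0. inverse h *\<^sub>R exp_var x v h = mc_form (h *\<^sub>R x) v"
    by (simp add: eventually_at_filter exp_var_def)
  ultimately show ?thesis
    by (subst has_vector_derivative_at_0_iff) (simp_all add: exp_var_def tendsto_cong)
qed

text \<open>The derivative of \<open>exp_var_add\<close> in \<open>h\<close> at \<open>0\<close>.\<close>
lemma exp_var_ode: "(exp_var x v has_vector_derivative v - bracket x (exp_var x v t)) (at t)"
proof -
  define \<beta> where "\<beta> = exp_var x v"
  have "((\<lambda>h. Ad (h *\<^sub>R (- x)) (\<beta> t) + \<beta> h) has_vector_derivative bracket (- x) (\<beta> t) + v) (at 0)"
    unfolding \<beta>_def
    by (intro has_vector_derivative_add has_vector_derivative_Ad exp_var_derivative_0)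
  then have "((\<lambda>h. \<beta> (t + h)) has_vector_derivative v - bracket x (\<beta> t)) (at 0)"
    using bilinear_lneg[OF bilinear_bracket, of x "\<beta> t"] by (simp add: exp_var_add \<beta>_def)
  moreover have "((\<lambda>s. s - t) has_vector_derivative 1) (at t)"
    by (auto intro!: derivative_eq_intros)
  ultimately have "((\<lambda>h. \<beta> (t + h)) \<circ> (\<lambda>s. s - t) has_vector_derivative 1 *\<^sub>R (v - bracket x (\<beta> t))) (at t)"
    by (intro vector_diff_chain_at) auto
  then show ?thesis by (simp add: o_def \<beta>_def)
qed

lemma mc_form_left_inverse: "mc_form x (m' (x, 0) (0, v)) = v"
proof -
  have "((\<lambda>y. m (- x) (m x y)) has_derivative (\<lambda>h. m' (- x, m x 0) (0, m' (x, 0) (0, h)))) (at 0)"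
    by (intro has_derivative_m has_derivative_const has_derivative_ident)
  then have "((\<lambda>y. y) has_derivative (\<lambda>h. mc_form x (m' (x, 0) (0, h)))) (at 0)"
    by (simp add: mc_form_def)
  from has_derivative_unique[OF this has_derivative_ident] show ?thesis by (simp add: fun_eq_iff)
qed

text \<open>The chain rule for \<open>y \<mapsto> x \<cdot> (b \<cdot> y)\<close>.  It reduces Jacobians of left translations to Jacobians at the
origin.\<close>
lemma left_translation_cocycle: "m' (x, b) (0, m' (b, 0) (0, v)) = m' (m x b, 0) (0, v)"
proof -
  have "((\<lambda>y. m x (m b y)) has_derivative (\<lambda>h. m' (x, m b 0) (0, m' (b, 0) (0, h)))) (at 0)"
    by (intro has_derivative_m has_derivative_const has_derivative_ident)
  moreover have "((\<lambda>y. m (m x b) y) has_derivative (\<lambda>h. m' (m x b, 0) (0, h))) (at 0)"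
    by (intro has_derivative_m has_derivative_const has_derivative_ident)
  ultimately have "(\<lambda>h. m' (x, m b 0) (0, m' (b, 0) (0, h))) = (\<lambda>h. m' (m x b, 0) (0, h))"
    unfolding assoc by (rule has_derivative_unique)
  then show ?thesis by (simp add: fun_eq_iff)
qed

lemma linear_deriv_snd: "linear (\<lambda>v. m' p (0, v))"
  using linear_compose[OF _ linear_deriv, of "\<lambda>v. (0, v)" p]
  by (simp add: o_def linear_iff)

end

section \<open>Stratifications and invariance of Lebesgue measure\<close>

locale graded_chart = chart_group m m'
  for m :: "'v::euclidean_space \<Rightarrow> 'v \<Rightarrow> 'v" and m' :: "'v \<times> 'v \<Rightarrow> 'v \<times> 'v \<Rightarrow> 'v" +
  fixes s :: nat and V :: "nat \<Rightarrow> 'v set"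
  assumes layer_subspace: "j \<in> {1..s} \<Longrightarrow> subspace (V j)"
    and layer_sum: "\<exists>!c. c \<in> (\<Pi>\<^sub>E j\<in>{1..s}. V j) \<and> x = (\<Sum>j=1..s. c j)"
    and layer_end: "V (s + 1) = {0}"
    and layer_bracket: "j \<in> {1..s} \<Longrightarrow> span {bracket x y |x y. x \<in> V 1 \<and> y \<in> V j} = V (j + 1)"
begin

text \<open>The descending filtration of the stratification; it reaches \<open>{0}\<close> at \<open>j = s + 1\<close>.\<close>
definition flag :: "nat \<Rightarrow> 'v set" where
  "flag j = span (\<Union>k\<in>{j..s}. V k)"

definition dil :: "real \<Rightarrow> 'v \<Rightarrow> 'v" where
  "dil t x = (\<Sum>j=1..s. t ^ j *\<^sub>R layer_parts s V x j)"

lemma subspace_flag: "subspace (flag j)"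
  by (simp add: flag_def subspace_span)

lemma flag_antimono: "i \<le> j \<Longrightarrow> flag j \<subseteq> flag i"
  unfolding flag_def by (intro span_mono UN_mono) auto

lemma layer_in_flag: "y \<in> V k \<Longrightarrow> k \<in> {j..s} \<Longrightarrow> y \<in> flag j"
  unfolding flag_def by (intro span_base) blast

lemma flag_1: "flag 1 = UNIV"
proof -
  have "x \<in> flag 1" for x
  proof -
    obtain c where c: "c \<in> (\<Pi>\<^sub>E j\<in>{1..s}. V j)" "x = (\<Sum>j=1..s. c j)" using layer_sum[of x] by blast
    then show ?thesis
      by (auto intro!: subspace_sum[OF subspace_flag] layer_in_flag dest: PiE_mem)
  qed
  then show ?thesis by blast
qed

lemma linear_bracket: "linear (bracket x)" "linear (\<lambda>x. bracket x y)"
  using bilinear_bracket by (auto simp: bilinear_def)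

lemma subspace_linear_vimage:
  fixes f :: "'v \<Rightarrow> 'v"
  shows "linear f \<Longrightarrow> subspace W \<Longrightarrow> subspace {x. f x \<in> W}"
  using linear_subspace_vimage[of f W] by (simp add: vimage_def)

lemma bracket_first_layer_flag:
  assumes "a \<in> V 1" "1 \<le> j" "y \<in> flag j"
  shows "bracket a y \<in> flag (j + 1)"
proof -
  have "(\<Union>k\<in>{j..s}. V k) \<subseteq> {y. bracket a y \<in> flag (j + 1)}"
  proof safe
    fix k y assume k: "k \<in> {j..s}" "y \<in> V k"
    have "bracket a y \<in> V (k + 1)"
      using k assms by (subst layer_bracket[symmetric]) (auto intro!: span_base)
    then show "bracket a y \<in> flag (j + 1)"
      using k layer_end by (cases "k = s") (auto simp: subspace_0[OF subspace_flag] intro: layer_in_flag)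
  qed
  then have "flag j \<subseteq> {y. bracket a y \<in> flag (j + 1)}"
    unfolding flag_def[of j] by (rule span_minimal) (intro subspace_linear_vimage linear_bracket subspace_flag)
  then show ?thesis using assms(3) by blast
qed

text \<open>The stratification gives this for \<open>x \<in> V 1\<close>.  Each further layer is spanned by brackets \<open>[a, b]\<close> with
\<open>a\<close> in the first layer and \<open>b\<close> in the previous one, and the Jacobi identity expresses
\<open>[[a, b], y]\<close> by iterated brackets with \<open>a\<close> and \<open>b\<close>.\<close>
lemma bracket_layer_flag:
  assumes "1 \<le> i" "i \<le> s" "x \<in> V i" "1 \<le> j" "y \<in> flag j"
  shows "bracket x y \<in> flag (j + 1)"
  using assms
proof (induction i arbitrary: x j y rule: dec_induct)
  case base
  then show ?case using bracket_first_layer_flag by blast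
next
  case (step i)
  have i: "i \<in> {1..s}" using step by auto
  have "{bracket a b |a b. a \<in> V 1 \<and> b \<in> V i} \<subseteq> {x. bracket x y \<in> flag (j + 1)}"
  proof safe
    fix a b assume ab: "a \<in> V 1" "b \<in> V i"
    have IH: "bracket b w \<in> flag (l + 1)" if "1 \<le> l" "w \<in> flag l" for w l
      using step.IH[of b l w] ab that i by auto
    have "bracket a (bracket b y) \<in> flag (j + 1 + 1)"
      using bracket_first_layer_flag[OF ab(1), of "j + 1"] IH step.prems by auto
    moreover have "bracket b (bracket a y) \<in> flag (j + 1 + 1)"
      using IH[of "j + 1"] bracket_first_layer_flag[OF ab(1)] step.prems by auto
    moreover have "bracket (bracket a b) y = bracket a (bracket b y) - bracket b (bracket a y)"
      using jacobi[of a b y] by simp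
    ultimately have "bracket (bracket a b) y \<in> flag (j + 1 + 1)"
      by (simp only: subspace_diff[OF subspace_flag])
    then show "bracket (bracket a b) y \<in> flag (j + 1)" using flag_antimono[of "j + 1" "j + 1 + 1"] by auto
  qed
  then have "span {bracket a b |a b. a \<in> V 1 \<and> b \<in> V i} \<subseteq> {x. bracket x y \<in> flag (j + 1)}"
    by (rule span_minimal) (intro subspace_linear_vimage linear_bracket subspace_flag)
  then have "V (i + 1) \<subseteq> {x. bracket x y \<in> flag (j + 1)}" using layer_bracket[OF i] by simp
  then show ?case using step.prems by auto
qed

lemma bracket_flag:
  assumes "1 \<le> j" "y \<in> flag j"
  shows "bracket x y \<in> flag (j + 1)"
proof -
  have "flag 1 \<subseteq> {x. bracket x y \<in> flag (j + 1)}"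
    unfolding flag_def[of 1]
  proof (rule span_minimal)
    show "(\<Union>k\<in>{1..s}. V k) \<subseteq> {x. bracket x y \<in> flag (j + 1)}"
      using bracket_layer_flag[OF _ _ _ assms] by auto
  qed (intro subspace_linear_vimage linear_bracket subspace_flag)
  then show ?thesis using flag_1 by blast
qed

text \<open>If the solution of the differential equation \<open>exp_var_ode\<close> stays in \<open>flag i\<close>, then its derivative is
\<open>v\<close> up to an error in \<open>flag (i + 1)\<close>.  So the solution climbs up the flag one step at a time until it
reaches the step of \<open>v\<close>, and once more it differs from \<open>t *\<^sub>R v\<close> by an element of the next step.\<close>
lemma mc_form_unipotent:
  assumes "1 \<le> j" "v \<in> flag j"
  shows "mc_form x v - v \<in> flag (j + 1)"
proof -
  have drift: "exp_var x v t - t *\<^sub>R v \<in> flag (i + 1)"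
    if "1 \<le> i" "\<And>t. exp_var x v t \<in> flag i" for i t
  proof (rule in_subspace_if_derivative_in[OF subspace_flag, where f = "\<lambda>t. exp_var x v t - t *\<^sub>R v"])
    show "((\<lambda>t. exp_var x v t - t *\<^sub>R v) has_vector_derivative (v - bracket x (exp_var x v t)) - v) (at t)" for t
      by (intro has_vector_derivative_diff exp_var_ode has_vector_derivative_line)
    show "v - bracket x (exp_var x v t) - v \<in> flag (i + 1)" for t
      using subspace_neg[OF subspace_flag bracket_flag[OF that]] by simp
    show "exp_var x v 0 - 0 *\<^sub>R v \<in> flag (i + 1)"
      by (simp add: exp_var_def subspace_0[OF subspace_flag])
  qed
  have "exp_var x v t \<in> flag i" if "1 \<le> i" "i \<le> j" for i t
    using that
  proof (induction i arbitrary: t rule: dec_induct)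
    case base
    then show ?case using flag_1 by simp
  next
    case (step i)
    have "t *\<^sub>R v \<in> flag (i + 1)"
      using assms(2) flag_antimono[of "i + 1" j] step.prems by (auto intro: subspace_scale[OF subspace_flag])
    moreover have "exp_var x v t - t *\<^sub>R v \<in> flag (i + 1)"
      using drift[of i t] step by auto
    ultimately have "exp_var x v t - t *\<^sub>R v + t *\<^sub>R v \<in> flag (i + 1)"
      by (intro subspace_add[OF subspace_flag])
    then show ?case by simp
  qed
  then have "exp_var x v 1 - 1 *\<^sub>R v \<in> flag (j + 1)"
    using assms(1) by (intro drift) auto
  then show ?thesis by (simp add: exp_var_def)
qed

lemma layer_parts_eqI:
  assumes "\<And>j. j \<in> {1..s} \<Longrightarrow> c j \<in> V j" "x = (\<Sum>j=1..s. c j)" "j \<in> {1..s}"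
  shows "layer_parts s V x j = c j"
proof -
  have "restrict c {1..s} \<in> (\<Pi>\<^sub>E j\<in>{1..s}. V j) \<and> x = (\<Sum>j=1..s. restrict c {1..s} j)"
    using assms by auto
  then have "layer_parts s V x = restrict c {1..s}"
    unfolding layer_parts_def using layer_sum[of x] by (intro the1_equality)
  then show ?thesis using assms(3) by simp
qed

lemma layer_parts:
  shows layer_parts_in: "j \<in> {1..s} \<Longrightarrow> layer_parts s V x j \<in> V j"
    and layer_parts_sum: "x = (\<Sum>j=1..s. layer_parts s V x j)"
proof -
  have "layer_parts s V x \<in> (\<Pi>\<^sub>E j\<in>{1..s}. V j) \<and> x = (\<Sum>j=1..s. layer_parts s V x j)"
    unfolding layer_parts_def using layer_sum[of x] by (rule theI')
  then show "j \<in> {1..s} \<Longrightarrow> layer_parts s V x j \<in> V j" "x = (\<Sum>j=1..s. layer_parts s V x j)"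
    by auto
qed

lemma linear_dil: "linear (dil t)"
proof (rule linearI)
  fix x y :: 'v and a :: real
  have "layer_parts s V (x + y) j = layer_parts s V x j + layer_parts s V y j" if "j \<in> {1..s}" for j
  proof (rule layer_parts_eqI[OF _ _ that])
    show "x + y = (\<Sum>j = 1..s. layer_parts s V x j + layer_parts s V y j)"
      unfolding sum.distrib using layer_parts_sum[of x] layer_parts_sum[of y] by simp
  qed (intro subspace_add layer_subspace layer_parts_in)
  then show "dil t (x + y) = dil t x + dil t y"
    by (simp add: dil_def scaleR_add_right sum.distrib[symmetric])
  have "layer_parts s V (a *\<^sub>R x) j = a *\<^sub>R layer_parts s V x j" if "j \<in> {1..s}" for j
  proof (rule layer_parts_eqI[OF _ _ that])
    show "a *\<^sub>R x = (\<Sum>j = 1..s. a *\<^sub>R layer_parts s V x j)"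
      unfolding scaleR_sum_right[symmetric] using layer_parts_sum[of x] by simp
  qed (intro subspace_scale layer_subspace layer_parts_in)
  then show "dil t (a *\<^sub>R x) = a *\<^sub>R dil t x"
    by (simp add: dil_def scaleR_sum_right mult.commute)
qed

lemma dil_layer:
  assumes "k \<in> {1..s}" "y \<in> V k"
  shows "dil t y = t ^ k *\<^sub>R y"
proof -
  define c where "c j = (if j = k then y else 0)" for j
  have "layer_parts s V y j = c j" if "j \<in> {1..s}" for j
  proof (rule layer_parts_eqI[OF _ _ that])
    show "y = (\<Sum>j = 1..s. c j)" using assms(1) by (simp add: c_def)
    show "c j \<in> V j" if "j \<in> {1..s}" for j
      using assms subspace_0[OF layer_subspace[OF that]] by (simp add: c_def)
  qed
  then have "dil t y = (\<Sum>j=1..s. t ^ j *\<^sub>R c j)" by (simp add: dil_def)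
  also have "\<dots> = (\<Sum>j=1..s. if j = k then t ^ k *\<^sub>R y else 0)"
    by (intro sum.cong) (auto simp: c_def)
  also have "\<dots> = t ^ k *\<^sub>R y" using assms(1) by simp
  finally show ?thesis .
qed

lemma in_span_layers: "x \<in> span (\<Union>k\<in>{1..s}. V k)"
  using flag_1 by (auto simp: flag_def)

lemma dil_dil: "dil t (dil u x) = dil (t * u) x"
proof (rule linear_eq_on[OF _ linear_dil in_span_layers])
  show "linear (\<lambda>x. dil t (dil u x))"
    using linear_compose[OF linear_dil linear_dil] by (simp add: o_def)
  fix y assume "y \<in> (\<Union>k\<in>{1..s}. V k)"
  then show "dil t (dil u y) = dil (t * u) y"
    by (auto simp: dil_layer linear_cmul[OF linear_dil] power_mult_distrib mult.commute)
qed

lemma dil_1: "dil 1 x = x"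
  using layer_parts_sum[of x] by (simp add: dil_def)

lemma dil_0: "dil 0 x = 0"
  by (auto simp: dil_def intro!: sum.neutral)

text \<open>On the layer \<open>l\<close> the map is multiplication by \<open>t ^ (l - k)\<close>, a positive power of \<open>t\<close>.\<close>
lemma tendsto_dil_flag:
  assumes "w \<in> flag (k + 1)"
  shows "((\<lambda>t. inverse t ^ k *\<^sub>R dil t w) \<longlongrightarrow> 0) (at_right 0)"
  using assms unfolding flag_def
proof (induction rule: span_induct_alt)
  case base
  then show ?case by (simp add: linear_0[OF linear_dil])
next
  case (step c x y)
  then obtain l where l: "l \<in> {k + 1..s}" "x \<in> V l" by auto
  have "((\<lambda>t::real. t ^ (l - k)) \<longlongrightarrow> 0 ^ (l - k)) (at_right 0)"
    by (intro tendsto_power tendsto_ident_at)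
  then have "((\<lambda>t::real. t ^ (l - k) *\<^sub>R x) \<longlongrightarrow> 0 *\<^sub>R x) (at_right 0)"
    using l by (intro tendsto_scaleR tendsto_const) (simp add: power_0_left)
  moreover have "\<forall>\<^sub>F t in at_right 0. inverse t ^ k *\<^sub>R dil t x = t ^ (l - k) *\<^sub>R x"
  proof -
    have "inverse t ^ k *\<^sub>R dil t x = t ^ (l - k) *\<^sub>R x" if "t > 0" for t :: real
    proof -
      have "inverse t ^ k * t ^ l = t ^ (l - k)"
        using that l by (simp add: power_diff field_simps)
      then show ?thesis using l by (simp add: dil_layer[of l])
    qed
    then show ?thesis by (simp add: eventually_at_filter)
  qed
  ultimately have "((\<lambda>t. inverse t ^ k *\<^sub>R dil t x) \<longlongrightarrow> 0) (at_right 0)"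
    by (simp add: tendsto_cong)
  then have "((\<lambda>t. c *\<^sub>R (inverse t ^ k *\<^sub>R dil t x) + inverse t ^ k *\<^sub>R dil t y) \<longlongrightarrow> c *\<^sub>R 0 + 0) (at_right 0)"
    using step by (intro tendsto_intros) auto
  then show ?case
    by (simp add: linear_add[OF linear_dil] linear_cmul[OF linear_dil] scaleR_add_right mult.commute)
qed

text \<open>Conjugation with \<open>dil t\<close> keeps the determinant and, as \<open>t\<close> tends to \<open>0\<close>, contracts the nilpotent part
\<open>T - id\<close> to zero.\<close>
lemma linear_det_unipotent:
  assumes T: "linear T" and uni: "\<And>j v. 1 \<le> j \<Longrightarrow> v \<in> flag j \<Longrightarrow> T v - v \<in> flag (j + 1)"
  shows "linear_det T = 1"
proof -
  have lim: "((\<lambda>t. dil t (T (dil (inverse t) v))) \<longlongrightarrow> v) (at_right 0)" for v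
    using in_span_layers[of v]
  proof (induction rule: span_induct_alt)
    case base
    then show ?case by (simp add: linear_0[OF linear_dil] linear_0[OF T])
  next
    case (step c x y)
    then obtain k where k: "k \<in> {1..s}" "x \<in> V k" by auto
    have "T x - x \<in> flag (k + 1)"
      using k by (intro uni layer_in_flag) auto
    from tendsto_add[OF tendsto_const tendsto_dil_flag[OF this], of x]
    have "((\<lambda>t. x + inverse t ^ k *\<^sub>R dil t (T x - x)) \<longlongrightarrow> x) (at_right 0)" by simp
    moreover have "\<forall>\<^sub>F t in at_right 0. dil t (T (dil (inverse t) x)) = x + inverse t ^ k *\<^sub>R dil t (T x - x)"
    proof -
      have "dil t (T (dil (inverse t) x)) = x + inverse t ^ k *\<^sub>R dil t (T x - x)" if "t > 0" for t :: real
        using that k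
        by (simp add: dil_layer linear_cmul[OF T] linear_cmul[OF linear_dil] linear_diff[OF linear_dil]
            scaleR_diff_right power_inverse)
      then show ?thesis by (simp add: eventually_at_filter)
    qed
    ultimately have "((\<lambda>t. dil t (T (dil (inverse t) x))) \<longlongrightarrow> x) (at_right 0)"
      by (simp add: tendsto_cong)
    then have "((\<lambda>t. c *\<^sub>R dil t (T (dil (inverse t) x)) + dil t (T (dil (inverse t) y))) \<longlongrightarrow> c *\<^sub>R x + y) (at_right 0)"
      using step by (intro tendsto_intros) auto
    then show ?case
      by (simp add: linear_add[OF linear_dil] linear_cmul[OF linear_dil] linear_add[OF T] linear_cmul[OF T])
  qed
  have dil_conj: "linear_det (\<lambda>v. dil t (T (dil (inverse t) v))) = linear_det T" if "t > 0" for t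
  proof -
    have lin: "linear (\<lambda>v. T (dil (inverse t) v))"
      using linear_compose[OF linear_dil T] by (simp add: o_def)
    have "linear_det (dil t) * linear_det (dil (inverse t)) = linear_det (\<lambda>v. dil t (dil (inverse t) v))"
      by (rule linear_det_compose[OF linear_dil linear_dil, symmetric])
    also have "\<dots> = 1" using that by (simp add: dil_dil dil_1 linear_det_id)
    finally have "linear_det (dil t) * linear_det (dil (inverse t)) = 1" .
    moreover have "linear_det (\<lambda>v. dil t (T (dil (inverse t) v))) = linear_det (dil t) * (linear_det T * linear_det (dil (inverse t)))"
      by (simp add: linear_det_compose[OF linear_dil lin] linear_det_compose[OF T linear_dil])
    ultimately show ?thesis by (simp add: mult.left_commute)
  qed
  have "((\<lambda>t. linear_det (\<lambda>v. dil t (T (dil (inverse t) v)))) \<longlongrightarrow> 1) (at_right 0)"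
    using lim by (rule tendsto_linear_det_id)
  moreover have "\<forall>\<^sub>F t in at_right 0. linear_det (\<lambda>v. dil t (T (dil (inverse t) v))) = linear_det T"
    by (simp add: eventually_at_filter dil_conj)
  ultimately have "((\<lambda>t::real. linear_det T) \<longlongrightarrow> 1) (at_right 0)"
    by (simp add: tendsto_cong)
  then show ?thesis by (simp add: tendsto_const_iff)
qed

lemma linear_det_left_translation: "linear_det (\<lambda>v. m' (x, b) (0, v)) = 1"
proof -
  have origin: "linear_det (\<lambda>v. m' (x, 0) (0, v)) = 1" for x
  proof -
    have "linear_det (mc_form x) * linear_det (\<lambda>v. m' (x, 0) (0, v)) = linear_det (\<lambda>v. mc_form x (m' (x, 0) (0, v)))"
      by (rule linear_det_compose[OF linear_mc_form linear_deriv_snd, symmetric])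
    also have "\<dots> = 1" by (simp add: mc_form_left_inverse linear_det_id)
    finally show ?thesis
      using linear_det_unipotent[OF linear_mc_form mc_form_unipotent, of x] by simp
  qed
  have "linear_det (\<lambda>v. m' (x, b) (0, v)) * linear_det (\<lambda>v. m' (b, 0) (0, v))
      = linear_det (\<lambda>v. m' (x, b) (0, m' (b, 0) (0, v)))"
    by (rule linear_det_compose[OF linear_deriv_snd linear_deriv_snd, symmetric])
  then show ?thesis by (simp add: left_translation_cocycle origin)
qed

lemma left_translation_derivative: "(m x has_derivative (\<lambda>h. m' (x, b) (0, h))) (at b)"
proof -
  have "((\<lambda>y. m x y) has_derivative (\<lambda>h. m' (x, b) (0, h))) (at b)"
    by (intro has_derivative_m has_derivative_const has_derivative_ident)
  then show ?thesis .
qed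

lemma left_translation_continuous: "continuous_on UNIV (m x)"
  using left_translation_derivative has_derivative_continuous
  by (intro continuous_at_imp_continuous_on) blast

lemma left_translation_image: "m x ` S = m (- x) -` S"
proof safe
  fix y assume "m (- x) y \<in> S"
  then have "m x (m (- x) y) \<in> m x ` S" by blast
  then show "y \<in> m x ` S" by simp
qed simp

lemma left_translation_preserves_lborel:
  assumes S: "S \<in> sets borel" "emeasure lborel S < \<infinity>"
  shows "emeasure lborel (m x ` S) = emeasure lborel S"
proof -
  have "m x ` S \<in> sets borel"
    unfolding left_translation_image
    using measurable_sets_borel[OF borel_measurable_continuous_onI[OF left_translation_continuous] S(1)] by simp
  moreover have "inj (m x)" by (metis injI m_cancel)
  ultimately have "emeasure lborel (m x ` S) = ennreal 1 * emeasure lborel S"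
    by (intro emeasure_image_constant_jacobian[OF S _ _ left_translation_derivative]) 
      (simp_all add: linear_det_left_translation)
  then show ?thesis by simp
qed

lemma emeasure_dil:
  assumes S: "S \<in> sets borel" "emeasure lborel S < \<infinity>" and "0 < t"
  shows "emeasure lborel (dil t ` S) = ennreal \<bar>linear_det (dil t)\<bar> * emeasure lborel S"
proof -
  have inv: "dil (inverse t) (dil t x) = x" "dil t (dil (inverse t) x) = x" for x
    using \<open>0 < t\<close> by (simp_all add: dil_dil dil_1)
  have bl: "bounded_linear (dil u)" for u
    using linear_dil by (simp add: linear_conv_bounded_linear)
  have "dil t ` S = dil (inverse t) -` S"
  proof safe
    fix y assume "dil (inverse t) y \<in> S"
    then have "dil t (dil (inverse t) y) \<in> dil t ` S" by blast
    then show "y \<in> dil t ` S" by (simp add: inv)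
  qed (simp add: inv)
  then have "dil t ` S \<in> sets borel"
    using measurable_sets_borel[OF borel_measurable_continuous_onI[OF linear_continuous_on[OF bl]] S(1)] by simp
  moreover have "inj (dil t)" by (metis injI inv(1))
  ultimately show ?thesis
    by (intro emeasure_image_constant_jacobian[OF S _ _ bounded_linear_imp_has_derivative[OF bl]]) simp_all
qed

end

section \<open>Maximal functions on doubling spaces\<close>

text \<open>The sets in the assumptions are the balls \<open>dball x r\<close> defined below.  The set \<open>D\<close> supplies the centres of
a countable family of balls that can replace the family of all balls.\<close>
locale doubling_space =
  fixes M :: "'a measure" and d :: "'a \<Rightarrow> 'a \<Rightarrow> real" and D :: "'a set" and K :: real
  assumes dist_self: "x \<in> space M \<Longrightarrow> d x x = 0"
    and dist_commute: "x \<in> space M \<Longrightarrow> y \<in> space M \<Longrightarrow> d x y = d y x"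
    and dist_triangle: "x \<in> space M \<Longrightarrow> y \<in> space M \<Longrightarrow> z \<in> space M \<Longrightarrow> d x z \<le> d x y + d y z"
    and ball_sets: "x \<in> space M \<Longrightarrow> {y \<in> space M. d x y < r} \<in> sets M"
    and ball_pos: "x \<in> space M \<Longrightarrow> 0 < r \<Longrightarrow> 0 < emeasure M {y \<in> space M. d x y < r}"
    and ball_finite: "x \<in> space M \<Longrightarrow> emeasure M {y \<in> space M. d x y < r} < \<infinity>"
    and doubling: "x \<in> space M \<Longrightarrow> 0 < r \<Longrightarrow>
      emeasure M {y \<in> space M. d x y < 2 * r} \<le> ennreal K * emeasure M {y \<in> space M. d x y < r}"
    and K_ge_1: "1 \<le> K"
    and countable_centres: "countable D"
    and centres_subset: "D \<subseteq> space M"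
    and dense_centres: "x \<in> space M \<Longrightarrow> 0 < r \<Longrightarrow> \<exists>q\<in>D. d x q < r"
begin

definition dball :: "'a \<Rightarrow> real \<Rightarrow> 'a set" where
  "dball x r = {y \<in> space M. d x y < r}"

lemma dball_sets [measurable]: "x \<in> space M \<Longrightarrow> dball x r \<in> sets M"
  unfolding dball_def by (rule ball_sets)

lemma centre_in_dball: "x \<in> space M \<Longrightarrow> 0 < r \<Longrightarrow> x \<in> dball x r"
  by (simp add: dball_def dist_self)

lemma dball_subset_space: "dball x r \<subseteq> space M"
  by (auto simp: dball_def)

lemma dball_measure:
  assumes "x \<in> space M" "0 < r"
  shows "emeasure M (dball x r) \<noteq> 0" "emeasure M (dball x r) < \<infinity>"
  using ball_pos[OF assms] ball_finite[OF assms(1), of r] by (auto simp: dball_def)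

lemma dball_double:
  assumes "x \<in> space M" "0 < r"
  shows "emeasure M (dball x (2 * r)) \<le> ennreal K * emeasure M (dball x r)"
  using doubling[OF assms] by (simp add: dball_def)

lemma sigma_finite: "sigma_finite_measure M"
proof (cases "space M = {}")
  case True
  show ?thesis by standard (use True in \<open>auto intro!: exI[of _ "{}"]\<close>)
next
  case False
  then obtain x where x: "x \<in> space M" by auto
  have "(\<Union>n::nat. dball x (real n)) = space M"
    using reals_Archimedean2 by (fastforce simp: dball_def)
  moreover have "emeasure M (dball x r) \<noteq> \<infinity>" for r
    using ball_finite[OF x, of r] by (auto simp: dball_def)
  ultimately show ?thesis
    using dball_sets[OF x]
    by (intro sigma_finite_measure.intro exI[of _ "range (\<lambda>n::nat. dball x (real n))"]) auto
qed

text \<open>Greedy selection: take a ball of largest radius, discard all balls that meet it, and continue with the rest.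
A discarded ball has at most the radius of the ball that it meets and so lies in its triple.\<close>
lemma finite_vitali_cover:
  assumes "finite F" "F \<subseteq> space M \<times> {0<..}"
  shows "\<exists>G\<subseteq>F. disjoint_family_on (\<lambda>(x, r). dball x r) G \<and>
    (\<Union>(x, r)\<in>F. dball x r) \<subseteq> (\<Union>(x, r)\<in>G. dball x (3 * r))"
  using assms
proof (induction "card F" arbitrary: F rule: less_induct)
  case less
  show ?case
  proof (cases "F = {}")
    case True
    then show ?thesis by (auto simp: disjoint_family_on_def)
  next
    case False
    have "Max (snd ` F) \<in> snd ` F"
      using less.prems False by (intro Max_in) auto
    then obtain p where p: "p \<in> F" "snd p = Max (snd ` F)" by auto
    have pmax: "snd q \<le> snd p" if "q \<in> F" for q
      using less.prems that p(2) by auto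
    define B where "B = (\<lambda>(x, r). dball x r)"
    have ps: "fst p \<in> space M" "0 < snd p" using p(1) less.prems by auto
    define F' where "F' = {q \<in> F. B q \<inter> B p = {}}"
    have "p \<notin> F'"
      using centre_in_dball[OF ps] by (auto simp: F'_def B_def split: prod.splits)
    then have "F' \<subset> F" using p(1) by (auto simp: F'_def)
    then have "card F' < card F" "finite F'" "F' \<subseteq> space M \<times> {0<..}"
      using less.prems by (auto simp: psubset_card_mono finite_subset)
    from less.hyps[OF this] obtain G where G: "G \<subseteq> F'" "disjoint_family_on B G"
      "(\<Union>q\<in>F'. B q) \<subseteq> (\<Union>(x, r)\<in>G. dball x (3 * r))"
      unfolding B_def by blast
    show ?thesis
    proof (intro exI[of _ "insert p G"] conjI)
      show "insert p G \<subseteq> F" using p(1) G(1) by (auto simp: F'_def)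
      show "disjoint_family_on (\<lambda>(x, r). dball x r) (insert p G)"
        using G(1,2) unfolding B_def[symmetric] by (auto simp: disjoint_family_on_def F'_def)
      show "(\<Union>(x, r)\<in>F. dball x r) \<subseteq> (\<Union>(x, r)\<in>insert p G. dball x (3 * r))"
      proof
        fix z assume "z \<in> (\<Union>(x, r)\<in>F. dball x r)"
        then obtain q where q: "q \<in> F" "z \<in> B q" by (auto simp: B_def)
        show "z \<in> (\<Union>(x, r)\<in>insert p G. dball x (3 * r))"
        proof (cases "q \<in> F'")
          case True
          then show ?thesis using G(3) q(2) by auto
        next
          case False
          then obtain w where w: "w \<in> B q" "w \<in> B p" using q by (auto simp: F'_def)
          have qs: "fst q \<in> space M" using q(1) less.prems by auto
          have sp: "z \<in> space M" "w \<in> space M" using q(2) w(1) by (auto simp: B_def dball_def split: prod.splits)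
          have "d (fst q) z < snd q" "d (fst q) w < snd q" "d (fst p) w < snd p"
            using q(2) w by (auto simp: B_def dball_def split: prod.splits)
          moreover have "d (fst p) z \<le> d (fst p) w + (d (fst q) w + d (fst q) z)"
            using dist_triangle[of "fst p" w z] dist_triangle[of w "fst q" z] dist_commute[of w "fst q"]
              ps qs sp by auto
          ultimately have "d (fst p) z < 3 * snd p" using pmax[OF q(1)] by linarith
          then have "z \<in> dball (fst p) (3 * snd p)" using sp by (simp add: dball_def)
          then show ?thesis by (auto split: prod.splits)
        qed
      qed
    qed
  qed
qed

text \<open>The uncentred maximal function over the balls with centre in \<open>D\<close> and rational radius.  By
\<open>ball_integral_le_maximal\<close> it dominates the averages over all balls, up to the factor \<open>K\<close>.\<close>
definition maximal :: "('a \<Rightarrow> ennreal) \<Rightarrow> 'a \<Rightarrow> ennreal" where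
  "maximal f x = (SUP (q, r)\<in>D \<times> (\<rat> \<inter> {0<..}).
     indicator (dball q r) x * ((\<integral>\<^sup>+y. f y * indicator (dball q r) y \<partial>M) / emeasure M (dball q r)))"

lemma countable_rational_balls: "countable (D \<times> (\<rat> \<inter> {0::real<..}))"
  using countable_centres countable_rat by (intro countable_SIGMA countable_Int1) auto

lemma maximal_measurable [measurable]:
  assumes [measurable]: "f \<in> borel_measurable M"
  shows "maximal f \<in> borel_measurable M"
proof -
  have "(\<lambda>x. SUP p\<in>D \<times> (\<rat> \<inter> {0<..}). (\<lambda>(q, r). indicator (dball q r) x *
      ((\<integral>\<^sup>+y. f y * indicator (dball q r) y \<partial>M) / emeasure M (dball q r))) p) \<in> borel_measurable M"
    using countable_rational_balls
    by (rule borel_measurable_SUP) (use centres_subset in \<open>auto split: prod.splits\<close>)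
  then show ?thesis unfolding maximal_def by simp
qed

lemma maximal_slice_measurable [measurable]:
  assumes [measurable]: "(\<lambda>(x, y). f x y) \<in> borel_measurable (M \<Otimes>\<^sub>M N)"
  shows "(\<lambda>(x, y). maximal (\<lambda>x'. f x' y) x) \<in> borel_measurable (M \<Otimes>\<^sub>M N)"
proof -
  interpret sigma_finite_measure M by (rule sigma_finite)
  have "(\<lambda>z. SUP p\<in>D \<times> (\<rat> \<inter> {0<..}). (\<lambda>(q, r). indicator (dball q r) (fst z) *
      ((\<integral>\<^sup>+x'. f x' (snd z) * indicator (dball q r) x' \<partial>M) / emeasure M (dball q r))) p)
      \<in> borel_measurable (M \<Otimes>\<^sub>M N)"
    using countable_rational_balls
  proof (rule borel_measurable_SUP, safe)
    fix q r assume "q \<in> D"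
    then have [measurable]: "dball q r \<in> sets M" using centres_subset by auto
    show "(\<lambda>z. indicator (dball q r) (fst z) *
      ((\<integral>\<^sup>+x'. f x' (snd z) * indicator (dball q r) x' \<partial>M) / emeasure M (dball q r)))
      \<in> borel_measurable (M \<Otimes>\<^sub>M N)"
      by measurable
  qed
  then show ?thesis unfolding maximal_def by (simp add: case_prod_beta')
qed

lemma maximal_superlevel:
  "{x \<in> space M. t < maximal f x} = (\<Union>(q, r)\<in>{(q, r). q \<in> D \<and> r \<in> \<rat> \<and> 0 < r \<and>
      t < (\<integral>\<^sup>+y. f y * indicator (dball q r) y \<partial>M) / emeasure M (dball q r)}. dball q r)"
  (is "?L = ?R")
proof
  show "?L \<subseteq> ?R"
  proof
    fix x assume "x \<in> ?L"
    then obtain q r where "q \<in> D" "r \<in> \<rat>" "0 < r" "t < indicator (dball q r) x *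
        ((\<integral>\<^sup>+y. f y * indicator (dball q r) y \<partial>M) / emeasure M (dball q r))"
      unfolding maximal_def less_SUP_iff by auto
    then show "x \<in> ?R" by (cases "x \<in> dball q r") auto
  qed
  show "?R \<subseteq> ?L"
  proof
    fix x assume "x \<in> ?R"
    then obtain q r where "q \<in> D" "r \<in> \<rat>" "0 < r" "x \<in> dball q r" 
      "t < (\<integral>\<^sup>+y. f y * indicator (dball q r) y \<partial>M) / emeasure M (dball q r)"
      by auto
    then show "x \<in> ?L"
      using dball_subset_space[of q r] unfolding maximal_def less_SUP_iff
      by (auto intro!: bexI[of _ q] bexI[of _ r])
  qed
qed

lemma sum_disjoint_le:
  assumes "finite G" "disjoint_family_on B G" "\<And>p. p \<in> G \<Longrightarrow> B p \<in> sets M" "f \<in> borel_measurable M"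
  shows "(\<Sum>p\<in>G. \<integral>\<^sup>+y. f y * indicator (B p) y \<partial>M) \<le> (\<integral>\<^sup>+y. f y \<partial>M)"
proof -
  have "(\<Sum>p\<in>G. \<integral>\<^sup>+y. f y * indicator (B p) y \<partial>M) = (\<integral>\<^sup>+y. (\<Sum>p\<in>G. f y * indicator (B p) y) \<partial>M)"
    using assms by (intro nn_integral_sum[symmetric]) auto
  also have "\<dots> = (\<integral>\<^sup>+y. f y * indicator (\<Union>p\<in>G. B p) y \<partial>M)"
    using assms(1,2) by (simp add: indicator_UN_disjoint sum_distrib_left)
  also have "\<dots> \<le> (\<integral>\<^sup>+y. f y \<partial>M)"
    by (intro nn_integral_mono) (auto simp: indicator_def)
  finally show ?thesis .
qed

text \<open>The disjoint balls of the Vitali lemma carry a fixed proportion of the measure of the union: tripling a ball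
costs at most two doublings, hence the factor \<open>K\<^sup>2\<close>.\<close>
lemma weak_type_finite:
  assumes f: "f \<in> borel_measurable M" and "finite F" "F \<subseteq> space M \<times> {0<..}"
    and avg: "\<And>x r. (x, r) \<in> F \<Longrightarrow> t < (\<integral>\<^sup>+y. f y * indicator (dball x r) y \<partial>M) / emeasure M (dball x r)"
  shows "t * emeasure M (\<Union>(x, r)\<in>F. dball x r) \<le> ennreal (K\<^sup>2) * (\<integral>\<^sup>+y. f y \<partial>M)"
proof -
  obtain G where G: "G \<subseteq> F" "disjoint_family_on (\<lambda>(x, r). dball x r) G"
    "(\<Union>(x, r)\<in>F. dball x r) \<subseteq> (\<Union>(x, r)\<in>G. dball x (3 * r))"
    using finite_vitali_cover[OF assms(2,3)] by blast
  have fin: "finite G" using G(1) assms(2) finite_subset by auto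
  have sp: "x \<in> space M" "0 < r" if "(x, r) \<in> G" for x r using that G(1) assms(3) by auto
  have triple: "emeasure M (dball x (3 * r)) \<le> ennreal (K\<^sup>2) * emeasure M (dball x r)"
    if "(x, r) \<in> G" for x r
  proof -
    note sp = sp[OF that]
    have "emeasure M (dball x (3 * r)) \<le> emeasure M (dball x (2 * (2 * r)))"
      using sp by (intro emeasure_mono) (auto simp: dball_def ball_sets)
    also have "\<dots> \<le> ennreal K * (ennreal K * emeasure M (dball x r))"
      using dball_double[OF sp(1), of "2 * r"] dball_double[OF sp] sp(2)
      by (meson order_trans mult_left_mono zero_le mult_pos_pos zero_less_numeral)
    also have "\<dots> = ennreal (K\<^sup>2) * emeasure M (dball x r)"
      using K_ge_1 by (simp add: power2_eq_square ennreal_mult mult.assoc)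
    finally show ?thesis .
  qed
  have avg': "t * emeasure M (dball x r) \<le> (\<integral>\<^sup>+y. f y * indicator (dball x r) y \<partial>M)"
    if "(x, r) \<in> G" for x r
  proof -
    note pos = dball_measure[OF sp[OF that]]
    have "t * emeasure M (dball x r)
      \<le> (\<integral>\<^sup>+y. f y * indicator (dball x r) y \<partial>M) / emeasure M (dball x r) * emeasure M (dball x r)"
      using avg[of x r] that G(1) by (intro mult_right_mono) (auto simp: less_imp_le)
    also have "\<dots> = (\<integral>\<^sup>+y. f y * indicator (dball x r) y \<partial>M)"
      using pos by (simp add: ennreal_divide_times ennreal_divide_self)
    finally show ?thesis .
  qed
  have "t * emeasure M (\<Union>(x, r)\<in>F. dball x r) \<le> t * emeasure M (\<Union>(x, r)\<in>G. dball x (3 * r))"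
    using G(3) fin sp by (intro mult_left_mono emeasure_mono sets.finite_UN) auto
  also have "\<dots> \<le> t * (\<Sum>(x, r)\<in>G. emeasure M (dball x (3 * r)))"
    unfolding case_prod_beta' using fin sp
    by (intro mult_left_mono emeasure_subadditive_finite) auto
  also have "\<dots> \<le> t * (\<Sum>(x, r)\<in>G. ennreal (K\<^sup>2) * emeasure M (dball x r))"
    using triple by (intro mult_left_mono sum_mono) auto
  also have "\<dots> = ennreal (K\<^sup>2) * (\<Sum>(x, r)\<in>G. t * emeasure M (dball x r))"
    by (simp add: sum_distrib_left case_prod_beta' mult_ac)
  also have "\<dots> \<le> ennreal (K\<^sup>2) * (\<Sum>(x, r)\<in>G. \<integral>\<^sup>+y. f y * indicator (dball x r) y \<partial>M)"
    using avg' by (intro mult_left_mono sum_mono) auto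
  also have "\<dots> \<le> ennreal (K\<^sup>2) * (\<integral>\<^sup>+y. f y \<partial>M)"
    using sum_disjoint_le[OF fin G(2) _ f] sp
    by (intro mult_left_mono) (auto simp: case_prod_beta')
  finally show ?thesis .
qed

text \<open>The superlevel set is the union of the countably many balls with large average, so it is exhausted by finite
unions of them.\<close>
lemma weak_type:
  assumes f: "f \<in> borel_measurable M"
  shows "t * emeasure M {x \<in> space M. t < maximal f x} \<le> ennreal (K\<^sup>2) * (\<integral>\<^sup>+y. f y \<partial>M)"
proof -
  define C where "C = {(q, r). q \<in> D \<and> r \<in> \<rat> \<and> 0 < r \<and>
      t < (\<integral>\<^sup>+y. f y * indicator (dball q r) y \<partial>M) / emeasure M (dball q r)}"
  define B where "B = (\<lambda>(x, r). dball x r)"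
  have E: "{x \<in> space M. t < maximal f x} = \<Union>(B ` C)"
    unfolding maximal_superlevel C_def B_def by simp
  have C: "C \<subseteq> D \<times> (\<rat> \<inter> {0::real<..})" by (auto simp: C_def)
  then have count: "countable C" by (rule countable_subset[OF _ countable_rational_balls])
  have Csp: "C \<subseteq> space M \<times> {0<..}" using C centres_subset by auto
  show ?thesis
  proof (cases "C = {}")
    case True
    then show ?thesis unfolding E by simp
  next
    case False
    define A where "A n = \<Union>(B ` (from_nat_into C ` {..n}))" for n
    have fin_in: "from_nat_into C ` {..n} \<subseteq> C" for n
      using from_nat_into[OF False] by auto
    have An: "t * emeasure M (A n) \<le> ennreal (K\<^sup>2) * (\<integral>\<^sup>+y. f y \<partial>M)" for n
      unfolding A_def B_def
    proof (rule weak_type_finite[OF f])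
      show "from_nat_into C ` {..n} \<subseteq> space M \<times> {0<..}" using fin_in[of n] Csp by blast
      fix x r assume "(x, r) \<in> from_nat_into C ` {..n}"
      then have "(x, r) \<in> C" using fin_in by blast
      then show "t < (\<integral>\<^sup>+y. f y * indicator (dball x r) y \<partial>M) / emeasure M (dball x r)"
        by (simp add: C_def)
    qed simp
    have "(\<Union>n. A n) = (\<Union>n. B (from_nat_into C n))"
      unfolding A_def by auto
    also have "\<dots> = \<Union>(B ` range (from_nat_into C))" by (simp add: image_image)
    also have "range (from_nat_into C) = C" by (rule range_from_nat_into[OF False count])
    finally have UA: "(\<Union>n. A n) = \<Union>(B ` C)" .
    have BC: "B p \<in> sets M" if "p \<in> C" for p
      using that Csp by (auto simp: B_def)
    have sup: "(SUP n. emeasure M (A n)) = emeasure M (\<Union>n. A n)"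
    proof (rule SUP_emeasure_incseq)
      have "A n \<in> sets M" for n
        unfolding A_def using fin_in[of n] BC by (intro sets.finite_UN) blast+
      then show "range A \<subseteq> sets M" by blast
      show "incseq A" unfolding A_def incseq_def
        by (intro allI impI Union_mono image_mono) simp
    qed
    have "t * emeasure M {x \<in> space M. t < maximal f x} = t * (SUP n. emeasure M (A n))"
      unfolding E sup UA ..
    also have "\<dots> = (SUP n. t * emeasure M (A n))" by (rule SUP_mult_left_ennreal)
    also have "\<dots> \<le> ennreal (K\<^sup>2) * (\<integral>\<^sup>+y. f y \<partial>M)" using An by (rule SUP_least)
    finally show ?thesis .
  qed
qed

lemma maximal_add_le:
  assumes f: "f \<in> borel_measurable M" "g \<in> borel_measurable M" and "\<And>x. x \<in> space M \<Longrightarrow> g x \<le> f x + t"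
  shows "maximal g x \<le> maximal f x + t"
  unfolding maximal_def[of g]
proof (rule SUP_least)
  fix p assume "p \<in> D \<times> (\<rat> \<inter> {0::real<..})"
  then obtain q r where p: "p = (q, r)" and q: "q \<in> D" "r \<in> \<rat>" "0 < r" by auto
  then have sp: "q \<in> space M" using centres_subset by auto
  let ?B = "dball q r"
  note pos = dball_measure[OF sp q(3)]
  have "(\<integral>\<^sup>+y. g y * indicator ?B y \<partial>M) \<le> (\<integral>\<^sup>+y. f y * indicator ?B y + t * indicator ?B y \<partial>M)"
    using assms(3) by (intro nn_integral_mono) (auto simp: indicator_def)
  also have "\<dots> = (\<integral>\<^sup>+y. f y * indicator ?B y \<partial>M) + t * emeasure M ?B"
    using f sp by (subst nn_integral_add) (auto simp: nn_integral_cmult_indicator)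
  finally have "(\<integral>\<^sup>+y. g y * indicator ?B y \<partial>M) / emeasure M ?B
      \<le> ((\<integral>\<^sup>+y. f y * indicator ?B y \<partial>M) + t * emeasure M ?B) / emeasure M ?B"
    by (rule divide_right_mono_ennreal)
  also have "\<dots> = (\<integral>\<^sup>+y. f y * indicator ?B y \<partial>M) / emeasure M ?B + t"
    using pos by (simp add: add_divide_distrib_ennreal ennreal_mult_divide_eq)
  finally have le1: "indicator ?B x * ((\<integral>\<^sup>+y. g y * indicator ?B y \<partial>M) / emeasure M ?B)
      \<le> indicator ?B x * ((\<integral>\<^sup>+y. f y * indicator ?B y \<partial>M) / emeasure M ?B) + t"
    by (cases "x \<in> ?B") simp_all
  let ?A = "\<lambda>(q, r). indicator (dball q r) x *
    ((\<integral>\<^sup>+y. f y * indicator (dball q r) y \<partial>M) / emeasure M (dball q r))"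
  have "?A (q, r) \<le> maximal f x"
    unfolding maximal_def using q by (intro SUP_upper) simp
  then have le2: "indicator ?B x * ((\<integral>\<^sup>+y. f y * indicator ?B y \<partial>M) / emeasure M ?B) \<le> maximal f x"
    by (simp only: prod.case)
  show "(case p of (q, r) \<Rightarrow> indicator (dball q r) x *
      ((\<integral>\<^sup>+y. g y * indicator (dball q r) y \<partial>M) / emeasure M (dball q r))) \<le> maximal f x + t"
    unfolding p prod.case by (rule order_trans[OF le1 add_right_mono[OF le2]])
qed

text \<open>The part of \<open>f\<close> below \<open>t / 2\<close> contributes at most \<open>t / 2\<close> to the maximal function, so only the part above
\<open>t / 2\<close> matters.\<close>
lemma weak_type_truncated:
  assumes [measurable]: "f \<in> borel_measurable M" and "0 \<le> t"
  shows "ennreal t * emeasure M {x \<in> space M. ennreal t < maximal f x}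
    \<le> ennreal (2 * K\<^sup>2) * (\<integral>\<^sup>+y. f y * indicator {y. ennreal (t / 2) < f y} y \<partial>M)"
proof -
  define g where "g y = f y * indicator {y. ennreal (t / 2) < f y} y" for y
  have g[measurable]: "g \<in> borel_measurable M"
  proof -
    have "g = (\<lambda>y. if ennreal (t / 2) < f y then f y else 0)" by (auto simp: g_def fun_eq_iff)
    then show ?thesis by simp
  qed
  have "f y \<le> g y + ennreal (t / 2)" for y
    by (auto simp: g_def indicator_def not_less)
  then have le: "maximal f x \<le> maximal g x + ennreal (t / 2)" for x
    by (intro maximal_add_le) auto
  have *: "ennreal (t / 2) < maximal g x" if "ennreal t < maximal f x" for x
  proof (rule ccontr)
    assume "\<not> ennreal (t / 2) < maximal g x"
    then have "maximal g x + ennreal (t / 2) \<le> ennreal (t / 2) + ennreal (t / 2)"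
      by (intro add_right_mono) (simp add: not_less)
    also have "\<dots> = ennreal t" using \<open>0 \<le> t\<close> by (subst ennreal_plus[symmetric]) auto
    finally have "maximal f x \<le> ennreal t" using le[of x] by (rule order_trans[rotated])
    then show False using that by (simp add: linorder_not_le[symmetric])
  qed
  define E where "E = emeasure M {x \<in> space M. ennreal (t / 2) < maximal g x}"
  have "{x \<in> space M. ennreal t < maximal f x} \<subseteq> {x \<in> space M. ennreal (t / 2) < maximal g x}"
    using * by blast
  then have 1: "emeasure M {x \<in> space M. ennreal t < maximal f x} \<le> E"
    unfolding E_def by (rule emeasure_mono) simp
  have 2: "ennreal t = 2 * ennreal (t / 2)"
    using \<open>0 \<le> t\<close> by (subst ennreal_numeral[symmetric], subst ennreal_mult[symmetric]) auto
  have 3: "ennreal (2 * K\<^sup>2) = 2 * ennreal (K\<^sup>2)"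
    by (subst ennreal_mult) simp_all
  have 4: "ennreal (t / 2) * E \<le> ennreal (K\<^sup>2) * (\<integral>\<^sup>+y. g y \<partial>M)"
    unfolding E_def by (rule weak_type[OF g])
  have "ennreal t * emeasure M {x \<in> space M. ennreal t < maximal f x} \<le> 2 * (ennreal (t / 2) * E)"
    unfolding mult.assoc[symmetric] 2[symmetric] by (rule mult_left_mono[OF 1]) simp
  also have "\<dots> \<le> ennreal (2 * K\<^sup>2) * (\<integral>\<^sup>+y. g y \<partial>M)"
    unfolding 3 mult.assoc by (rule mult_left_mono[OF 4]) simp
  finally show ?thesis unfolding g_def .
qed

end

section \<open>The dyadic bound in L log L\<close>

lemma indicator_superlevel_measurable:
  fixes h :: "'a \<Rightarrow> ennreal"
  assumes [measurable]: "h \<in> borel_measurable N"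
  shows "(\<lambda>x. indicator {z. c < z} (h x) :: ennreal) \<in> borel_measurable N"
proof -
  have "(\<lambda>x. indicator {z. c < z} (h x) :: ennreal) = (\<lambda>x. if c < h x then 1 else 0)"
    by (auto simp: fun_eq_iff)
  then show ?thesis by simp
qed

text \<open>A discrete layer cake formula: if there is a largest \<open>k\<close> with \<open>2 ^ k * a < g\<close>, its term alone is at least
\<open>g\<close>; otherwise the sum is infinite.\<close>
lemma dyadic_upper_bound:
  fixes g :: ennreal
  assumes "0 < a"
  shows "g * indicator {y. ennreal a < y} g
    \<le> (\<Sum>k. ennreal (2 * (2 ^ k * a)) * indicator {y. ennreal (2 ^ k * a) < y} g)"
  (is "?L \<le> (\<Sum>k. ?f k)")
proof -
  define F where "F = ?f"
  have single: "?f k \<le> (\<Sum>k. ?f k)" for k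
    using sum_le_suminf[of F "{k}"] by (simp add: F_def[symmetric] fun_cong[OF F_def[symmetric]])
  consider "g \<le> ennreal a" | "\<And>k. ennreal (2 ^ k * a) < g"
    | n where "ennreal a < g" "\<not> ennreal (2 ^ n * a) < g" by (meson linorder_not_le)
  then show ?thesis
  proof cases
    case 1
    then show ?thesis by (simp add: linorder_not_less[symmetric])
  next
    case 2
    have "(\<Sum>k. ?f k) = \<infinity>"
    proof (rule ccontr)
      assume "(\<Sum>k. ?f k) \<noteq> \<infinity>"
      then obtain c where c: "0 \<le> c" "(\<Sum>k. ?f k) = ennreal c" by (cases "\<Sum>k. ?f k") auto
      obtain k where "c / a < 2 ^ k" using real_arch_pow[of 2 "c / a"] by auto
      then have "c < 2 ^ k * a" using assms by (simp add: pos_divide_less_eq)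
      then have "c < 2 * (2 ^ k * a)" using c(1) by linarith
      then have "ennreal c < ?f k" using 2[of k] c(1) by (simp add: ennreal_lessI)
      then show False using single[of k] c(2) by simp
    qed
    then show ?thesis by simp
  next
    case 3
    define N where "N = (LEAST n. \<not> ennreal (2 ^ n * a) < g)"
    have N: "\<not> ennreal (2 ^ N * a) < g" unfolding N_def using 3(2) by (rule LeastI)
    then have "N \<noteq> 0" using 3(1) by (cases "N = 0") auto
    then obtain k where k: "N = Suc k" by (cases N) auto
    then have "ennreal (2 ^ k * a) < g" using not_less_Least[of k "\<lambda>n. \<not> ennreal (2 ^ n * a) < g"] N_def by auto
    moreover have "g \<le> ennreal (2 * (2 ^ k * a))" using N k by (simp add: mult.assoc)
    ultimately have "?L \<le> ?f k" using 3(1) by simp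
    then show ?thesis using single[of k] by (rule order_trans)
  qed
qed

text \<open>The sum counts the \<open>k\<close> with \<open>2 ^ k < w\<close>, where \<open>w = 4 * \<kappa> * u / lam\<close>.  There are at most
\<open>log 2 w + 1\<close> of them if \<open>w > 1\<close>, and none otherwise.\<close>
lemma dyadic_count_le_log:
  fixes u lam \<kappa> :: real
  assumes "0 \<le> u" "0 < lam" "1 \<le> \<kappa>"
  shows "(\<Sum>k. indicator {y. ennreal (2 ^ k * (lam / \<kappa> / 2) / 2) < y} (ennreal u) :: ennreal)
    \<le> ennreal ((log 2 \<kappa> + 5) * ln (exp 1 + u / lam))"
proof -
  define v where "v = u / lam"
  define w where "w = 4 * \<kappa> * v"
  define n where "n = nat \<lceil>log 2 w\<rceil>"
  have v: "0 \<le> v" using assms by (simp add: v_def)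
  have ln_ge: "1 \<le> ln (exp 1 + v)"
    using v ln_mono[of "exp 1" "exp 1 + v"] by simp
  have zero: "\<not> ennreal (2 ^ k * (lam / \<kappa> / 2) / 2) < ennreal u" if "n \<le> k" for k
  proof -
    have "w \<le> 2 ^ k"
    proof (cases "0 < w")
      case True
      have "log 2 w \<le> real k" using that unfolding n_def by linarith
      then have "w \<le> 2 powr real k" using True by (simp add: log_le_iff)
      then show ?thesis by (simp add: powr_realpow)
    next
      case False
      then show ?thesis using zero_less_power[of "2::real" k] by linarith
    qed
    then have "u \<le> 2 ^ k * (lam / \<kappa> / 2) / 2"
      using assms by (simp add: w_def v_def field_simps)
    then have "ennreal u \<le> ennreal (2 ^ k * (lam / \<kappa> / 2) / 2)" by (rule ennreal_leI)
    then show ?thesis by (simp add: linorder_not_less)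
  qed
  have "(\<Sum>k. indicator {y. ennreal (2 ^ k * (lam / \<kappa> / 2) / 2) < y} (ennreal u) :: ennreal)
      = (\<Sum>k<n. indicator {y. ennreal (2 ^ k * (lam / \<kappa> / 2) / 2) < y} (ennreal u))"
    by (rule suminf_finite) (use zero in \<open>auto simp: linorder_not_less\<close>)
  also have "\<dots> \<le> (\<Sum>k<n. 1)"
    by (intro sum_mono) (auto simp: indicator_def)
  also have "\<dots> = ennreal (real n)" by (simp add: ennreal_of_nat_eq_real_of_nat)
  also have "\<dots> \<le> ennreal ((log 2 \<kappa> + 5) * ln (exp 1 + v))"
  proof (rule ennreal_leI)
    have l\<kappa>: "0 \<le> log 2 \<kappa>" using assms by simp
    show "real n \<le> (log 2 \<kappa> + 5) * ln (exp 1 + v)"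
    proof (cases "0 < log 2 w")
      case False
      then have "n = 0" unfolding n_def by simp
      then show ?thesis using l\<kappa> ln_ge by simp
    next
      case True
      have "v \<noteq> 0"
      proof
        assume "v = 0"
        then have "log 2 w = 0" by (simp add: w_def log_def)
        then show False using True by simp
      qed
      then have "0 < v" using v by simp
      have "log 2 w = log 2 4 + log 2 \<kappa> + log 2 v"
        using \<open>0 < v\<close> assms by (simp add: w_def log_mult)
      also have "log 2 4 = (2::real)"
        using log_pow_cancel[of 2 2] by simp
      finally have lw: "log 2 w = 2 + log 2 \<kappa> + log 2 v" .
      have "ln v \<le> ln (exp 1 + v)" using \<open>0 < v\<close> by (simp add: add_pos_pos)
      moreover have "1 / 2 * ln (exp 1 + v) \<le> ln 2 * ln (exp 1 + v)"
        using ln2_ge_two_thirds ln_ge by (intro mult_right_mono) auto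
      ultimately have "ln v \<le> 2 * ln (exp 1 + v) * ln 2" by (simp add: mult.commute)
      then have "log 2 v \<le> 2 * ln (exp 1 + v)"
        by (simp add: log_def divide_le_eq)
      moreover have "real n \<le> log 2 w + 1" using True unfolding n_def by linarith
      ultimately have "real n \<le> (3 + log 2 \<kappa>) * 1 + 2 * ln (exp 1 + v)" using lw by simp
      also have "\<dots> \<le> (3 + log 2 \<kappa>) * ln (exp 1 + v) + 2 * ln (exp 1 + v)"
        using l\<kappa> ln_ge by (intro add_right_mono mult_left_mono) auto
      also have "\<dots> = (log 2 \<kappa> + 5) * ln (exp 1 + v)" by (simp add: algebra_simps)
      finally show ?thesis .
    qed
  qed
  finally show ?thesis unfolding v_def .
qed

context doubling_space
begin

text \<open>Apply \<open>weak_type_truncated\<close> at every dyadic height \<open>2 ^ k * a\<close>: the factor \<open>2 ^ k * a\<close> from the layer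
cake formula is exactly the one on the left of the weak type inequality, so each height costs the same.\<close>
lemma llogl_dyadic:
  assumes f[measurable]: "f \<in> borel_measurable M" and "0 < a"
  shows "(\<integral>\<^sup>+x. maximal f x * indicator {y. ennreal a < y} (maximal f x) \<partial>M)
    \<le> ennreal (4 * K\<^sup>2) * (\<integral>\<^sup>+y. f y * (\<Sum>k. indicator {z. ennreal (2 ^ k * a / 2) < z} (f y)) \<partial>M)"
proof -
  have term_le: "(\<integral>\<^sup>+x. ennreal (2 * (2 ^ k * a)) * indicator {y. ennreal (2 ^ k * a) < y} (maximal f x) \<partial>M)
      \<le> ennreal (4 * K\<^sup>2) * (\<integral>\<^sup>+y. f y * indicator {z. ennreal (2 ^ k * a / 2) < z} (f y) \<partial>M)" for k
  proof -
    let ?E = "{x \<in> space M. ennreal (2 ^ k * a) < maximal f x}"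
    have "(\<integral>\<^sup>+x. ennreal (2 * (2 ^ k * a)) * indicator {y. ennreal (2 ^ k * a) < y} (maximal f x) \<partial>M)
        = (\<integral>\<^sup>+x. ennreal (2 * (2 ^ k * a)) * indicator ?E x \<partial>M)"
      by (intro nn_integral_cong) (simp add: indicator_def)
    also have "\<dots> = ennreal (2 * (2 ^ k * a)) * emeasure M ?E"
      by (rule nn_integral_cmult_indicator) measurable
    also have "\<dots> = ennreal 2 * (ennreal (2 ^ k * a) * emeasure M ?E)"
      using \<open>0 < a\<close> by (subst ennreal_mult) (simp_all add: mult.assoc)
    also have "\<dots> \<le> ennreal 2 * (ennreal (2 * K\<^sup>2) *
        (\<integral>\<^sup>+y. f y * indicator {y. ennreal (2 ^ k * a / 2) < f y} y \<partial>M))"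
      using \<open>0 < a\<close> by (intro mult_left_mono weak_type_truncated[OF f]) simp_all
    also have "\<dots> = ennreal (2 * (2 * K\<^sup>2)) *
        (\<integral>\<^sup>+y. f y * indicator {y. ennreal (2 ^ k * a / 2) < f y} y \<partial>M)"
      by (subst (2) ennreal_mult) (simp_all only: mult.assoc zero_le_numeral zero_le_power2 mult_nonneg_nonneg)
    also have "\<dots> = ennreal (4 * K\<^sup>2) * (\<integral>\<^sup>+y. f y * indicator {z. ennreal (2 ^ k * a / 2) < z} (f y) \<partial>M)"
      by (simp add: indicator_def)
    finally show ?thesis .
  qed
  have "(\<integral>\<^sup>+x. maximal f x * indicator {y. ennreal a < y} (maximal f x) \<partial>M)
      \<le> (\<integral>\<^sup>+x. (\<Sum>k. ennreal (2 * (2 ^ k * a)) * indicator {y. ennreal (2 ^ k * a) < y} (maximal f x)) \<partial>M)"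
    using \<open>0 < a\<close> by (intro nn_integral_mono dyadic_upper_bound)
  also have "\<dots> = (\<Sum>k. \<integral>\<^sup>+x. ennreal (2 * (2 ^ k * a)) * indicator {y. ennreal (2 ^ k * a) < y} (maximal f x) \<partial>M)"
    by (rule nn_integral_suminf) (use indicator_superlevel_measurable[OF maximal_measurable[OF f]] in measurable)
  also have "\<dots> \<le> (\<Sum>k. ennreal (4 * K\<^sup>2) *
      (\<integral>\<^sup>+y. f y * indicator {z. ennreal (2 ^ k * a / 2) < z} (f y) \<partial>M))"
    by (intro suminf_le term_le) auto
  also have "\<dots> = ennreal (4 * K\<^sup>2) * (\<Sum>k. \<integral>\<^sup>+y. f y * indicator {z. ennreal (2 ^ k * a / 2) < z} (f y) \<partial>M)"
    by (rule ennreal_suminf_cmult)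
  also have "(\<Sum>k. \<integral>\<^sup>+y. f y * indicator {z. ennreal (2 ^ k * a / 2) < z} (f y) \<partial>M)
      = (\<integral>\<^sup>+y. (\<Sum>k. f y * indicator {z. ennreal (2 ^ k * a / 2) < z} (f y)) \<partial>M)"
    by (rule nn_integral_suminf[symmetric]) (use f indicator_superlevel_measurable[OF f] in measurable)
  also have "\<dots> = (\<integral>\<^sup>+y. f y * (\<Sum>k. indicator {z. ennreal (2 ^ k * a / 2) < z} (f y)) \<partial>M)"
    by (simp only: ennreal_suminf_cmult)
  finally show ?thesis .
qed

text \<open>Balls are unions of balls of the countable family; this makes the superlevel sets of the strong maximal
function measurable.\<close>
lemma rational_ball_inside:
  assumes "x \<in> space M" "g \<in> dball x r"
  shows "\<exists>q\<in>D. \<exists>r'\<in>\<rat> \<inter> {0<..}. g \<in> dball q r' \<and> dball q r' \<subseteq> dball x r"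
proof -
  have g: "g \<in> space M" "d x g < r" using assms(2) by (auto simp: dball_def)
  obtain r' where r': "r' \<in> \<rat>" "0 < r'" "r' < (r - d x g) / 2"
    using Rats_dense_in_real[of 0 "(r - d x g) / 2"] g(2) by auto
  obtain q where q: "q \<in> D" "d g q < r'" using dense_centres[OF g(1) r'(2)] by blast
  have qs: "q \<in> space M" using q(1) centres_subset by blast
  have "dball q r' \<subseteq> dball x r"
  proof
    fix y assume y: "y \<in> dball q r'"
    then have ys: "y \<in> space M" "d q y < r'" by (auto simp: dball_def)
    have "d x y \<le> d x g + d g y" "d g y \<le> d g q + d q y"
      using dist_triangle assms(1) g(1) qs ys(1) by blast+
    then have "d x y < r" using q(2) ys(2) r'(3) by (simp add: field_simps)
    then show "y \<in> dball x r" using ys(1) by (simp add: dball_def)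
  qed
  moreover have "g \<in> dball q r'" using g(1) q(2) dist_commute[OF g(1) qs] by (simp add: dball_def)
  ultimately show ?thesis using q(1) r' by blast
qed

text \<open>Move the centre by less than \<open>r / 4\<close> and take a radius between \<open>5 / 4 * r\<close> and \<open>3 / 2 * r\<close>: the new
ball contains the old one and is contained in its double.\<close>
lemma rational_ball_outside:
  assumes x: "x \<in> space M" and "0 < r"
  shows "\<exists>q\<in>D. \<exists>r'\<in>\<rat> \<inter> {0<..}. dball x r \<subseteq> dball q r' \<and>
    emeasure M (dball q r') \<le> ennreal K * emeasure M (dball x r)"
proof -
  obtain r' where r': "r' \<in> \<rat>" "5 / 4 * r < r'" "r' < 3 / 2 * r"
    using Rats_dense_in_real[of "5 / 4 * r" "3 / 2 * r"] \<open>0 < r\<close> by auto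
  obtain q where q: "q \<in> D" "d x q < r / 4" using dense_centres[OF x, of "r / 4"] \<open>0 < r\<close> by auto
  have qs: "q \<in> space M" using q(1) centres_subset by blast
  have "dball x r \<subseteq> dball q r'"
  proof
    fix y assume "y \<in> dball x r"
    then have y: "y \<in> space M" "d x y < r" by (auto simp: dball_def)
    have "d q y \<le> d q x + d x y" "d q x = d x q"
      using dist_triangle dist_commute x y(1) qs by blast+
    then have "d q y < r'" using q(2) y(2) r'(2) by linarith
    then show "y \<in> dball q r'" using y(1) by (simp add: dball_def)
  qed
  moreover have "dball q r' \<subseteq> dball x (2 * r)"
  proof
    fix y assume "y \<in> dball q r'"
    then have y: "y \<in> space M" "d q y < r'" by (auto simp: dball_def)
    have "d x y \<le> d x q + d q y" using dist_triangle x y(1) qs by blast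
    then have "d x y < 2 * r" using q(2) y(2) r'(3) \<open>0 < r\<close> by linarith
    then show "y \<in> dball x (2 * r)" using y(1) by (simp add: dball_def)
  qed
  then have "emeasure M (dball q r') \<le> emeasure M (dball x (2 * r))"
    using x by (intro emeasure_mono dball_sets)
  then have "emeasure M (dball q r') \<le> ennreal K * emeasure M (dball x r)"
    using dball_double[OF assms] by (rule order_trans)
  moreover have "r' \<in> \<rat> \<inter> {0<..}" using r' \<open>0 < r\<close> by simp
  ultimately show ?thesis using q(1) by blast
qed

lemma ball_integral_le_maximal:
  assumes x: "x \<in> space M" and "0 < r" and g: "g \<in> dball x r"
  shows "(\<integral>\<^sup>+y. f y * indicator (dball x r) y \<partial>M) \<le> ennreal K * emeasure M (dball x r) * maximal f g"
proof -
  obtain q r' where q: "q \<in> D" "r' \<in> \<rat> \<inter> {0<..}" "dball x r \<subseteq> dball q r'"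
    "emeasure M (dball q r') \<le> ennreal K * emeasure M (dball x r)"
    using rational_ball_outside[OF assms(1,2)] by blast
  have qs: "q \<in> space M" using q(1) centres_subset by blast
  have r': "0 < r'" using q(2) by simp
  note pos = dball_measure[OF qs r']
  let ?I = "\<integral>\<^sup>+y. f y * indicator (dball q r') y \<partial>M"
  let ?A = "\<lambda>(q, r). indicator (dball q r) g * ((\<integral>\<^sup>+y. f y * indicator (dball q r) y \<partial>M) / emeasure M (dball q r))"
  have "?A (q, r') \<le> maximal f g"
    unfolding maximal_def using q(1,2) by (intro SUP_upper) simp
  moreover have "g \<in> dball q r'" using g q(3) by blast
  ultimately have avg: "?I / emeasure M (dball q r') \<le> maximal f g" by simp
  have "(\<integral>\<^sup>+y. f y * indicator (dball x r) y \<partial>M) \<le> ?I"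
    using q(3) by (intro nn_integral_mono mult_left_mono) (auto simp: indicator_def)
  also have "?I = emeasure M (dball q r') * (?I / emeasure M (dball q r'))"
    unfolding ennreal_times_divide
    by (subst mult.commute, rule mult_divide_eq_ennreal[symmetric]) (use pos in auto)
  also have "\<dots> \<le> (ennreal K * emeasure M (dball x r)) * maximal f g"
    using q(4) avg by (intro mult_mono) auto
  finally show ?thesis .
qed

end

section \<open>Haar measure on a stratified group is doubling\<close>

context stratified_group
begin

definition chart_mult :: "'v \<Rightarrow> 'v \<Rightarrow> 'v" where
  "chart_mult x y = logG expG (expG x \<otimes> expG y)"

lemma log_exp [simp]: "logG expG (expG x) = x"
  using homeo by (simp add: homeomorphism_def)

lemma exp_log: "g \<in> carrier G \<Longrightarrow> expG (logG expG g) = g"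
  using homeo by (simp add: homeomorphism_def)

lemma exp_carrier [simp]: "expG x \<in> carrier G"
  using homeo by (auto simp: homeomorphism_def)

lemma range_exp: "range expG = carrier G"
  using homeo by (simp add: homeomorphism_def)

lemma inj_exp: "inj expG"
  by (metis injI log_exp)

lemma exp_chart_mult: "expG (chart_mult x y) = expG x \<otimes> expG y"
  by (simp add: chart_mult_def exp_log)

lemma exp_0: "expG 0 = \<one>"
  using one_parameter[of 0 0 0] by simp

lemma inv_exp: "inv (expG x) = expG (- x)"
proof (rule inv_equality)
  show "expG (- x) \<otimes> expG x = \<one>"
    using one_parameter[of "-1" 1 x] by (simp add: exp_0)
qed simp_all

text \<open>The Lie bracket of the group, which is defined by derivatives, agrees with the bracket of the chart: since
conjugation is linear in the chart, \<open>Ad_map\<close> is conjugation itself.\<close>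
lemma graded_chart_exists: "\<exists>m'. graded_chart chart_mult m' s V"
proof -
  have "C_on (Suc 0) UNIV (\<lambda>(x, y). chart_mult x y)"
    using smooth_mult unfolding smooth_on_def chart_mult_def by blast
  then obtain m' where m': "\<And>p. ((\<lambda>(x, y). chart_mult x y) has_derivative m' p) (at p)"
      "\<And>v. continuous_on UNIV (\<lambda>p. m' p v)"
    by auto
  interpret chart_group chart_mult m'
  proof
    show "chart_mult (chart_mult x y) z = chart_mult x (chart_mult y z)" for x y z
      by (simp add: chart_mult_def exp_log m_assoc)
    show "chart_mult (a *\<^sub>R x) (b *\<^sub>R x) = (a + b) *\<^sub>R x" for a b x
      by (simp add: chart_mult_def one_parameter[symmetric])
  qed (rule m')+
  have Ad_log: "logG expG (expG z \<otimes> expG y \<otimes> inv (expG z)) = Ad z y" for z y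
    by (simp add: Ad_def inv_exp chart_mult_def exp_log)
  have Ad_map_eq: "Ad_map G expG (expG z) y = Ad z y" for z y
    unfolding Ad_map_def Ad_log linear_cmul[OF linear_Ad]
    by (intro vector_derivative_at has_vector_derivative_line)
  have bracket_eq: "lie_bracket G expG x y = bracket x y" for x y
    unfolding lie_bracket_def Ad_map_eq by (intro vector_derivative_at has_vector_derivative_Ad)
  have "graded_chart chart_mult m' s V"
  proof (unfold_locales)
    show "\<exists>!c. c \<in> (\<Pi>\<^sub>E j\<in>{1..s}. V j) \<and> x = (\<Sum>j=1..s. c j)" for x
      by (rule layer_direct_sum)
    show "span {bracket x y |x y. x \<in> V 1 \<and> y \<in> V j} = V (j + 1)" if "j \<in> {1..s}" for j
      using layer_bracket[OF that] by (simp add: bracket_eq)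
  qed (use layer_subspace layer_beyond in simp_all)
  then show ?thesis by blast
qed

lemma space_haar: "space (haar expG) = carrier G"
  by (simp add: haar_def space_embed_measure range_exp)

lemma emeasure_haar_image:
  assumes "A \<in> sets borel"
  shows "expG ` A \<in> sets (haar expG)" "emeasure (haar expG) (expG ` A) = emeasure lborel A"
  using assms by (simp_all add: haar_def in_sets_embed_measure emeasure_embed_measure_image inj_exp)

end

context normed_stratified_group
begin

text \<open>In the chart every ball is a left translate of a sublevel set \<open>U R\<close> of the norm, and \<open>U\<close> scales with
dilations.\<close>
lemma haar_doubling_space:
  "\<exists>D K. doubling_space (haar expG) (\<lambda>g h. \<rho> (inv g \<otimes> h)) D K"
proof -
  obtain m' where "graded_chart chart_mult m' s V" using graded_chart_exists by blast
  then interpret graded_chart chart_mult m' s V .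
  define r where "r x = \<rho> (expG x)" for x
  have r_nonneg: "0 \<le> r x" for x by (simp add: r_def norm_nonneg)
  have r_minus: "r (- x) = r x" for x
    unfolding r_def inv_exp[symmetric] by (rule norm_inv) simp
  have r_add: "r (chart_mult x y) \<le> r x + r y" for x y
    using norm_triangle[of "expG (- x)" "expG y"] r_minus
    by (simp add: inv_exp exp_chart_mult r_def)
  have r_0_iff: "r x = 0 \<longleftrightarrow> x = 0" for x
    using norm_eq_0_iff[of "expG x"] inj_exp unfolding r_def exp_0[symmetric] by (simp add: inj_eq)
  have r_dil: "r (dil t x) = t * r x" if "0 < t" for t x
    using norm_dilation[OF that, of "expG x"] by (simp add: r_def dilation_def dil_def)
  have "continuous_on UNIV expG" using homeo by (simp add: homeomorphism_def)
  then have r_cont: "continuous_on UNIV r"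
    unfolding r_def[abs_def] by (intro continuous_on_compose2[OF norm_continuous]) auto
  define U where "U R = {x. r x < R}" for R
  have U_open: "open (U R)" for R
    unfolding U_def using r_cont by (intro open_Collect_less continuous_intros)
  have U_borel: "U R \<in> sets borel" for R using U_open by simp
  have dil_U: "dil t ` U R = U (t * R)" if "0 < t" for t R
  proof safe
    fix x assume "x \<in> U R"
    then show "dil t x \<in> U (t * R)" using that by (simp add: U_def r_dil)
  next
    fix x assume "x \<in> U (t * R)"
    then have "inverse t * r x < R" using that by (simp add: U_def field_simps)
    then have "dil (inverse t) x \<in> U R" using that by (simp add: U_def r_dil)
    moreover have "x = dil t (dil (inverse t) x)" using that by (simp add: dil_dil dil_1)
    ultimately show "x \<in> dil t ` U R" by blast
  qed
  \<comment> \<open>the minimum of the norm on the Euclidean unit sphere\<close>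
  obtain c where c: "0 < c" "\<And>x. norm x = 1 \<Longrightarrow> c \<le> r x"
  proof -
    obtain b :: 'v where "b \<in> Basis" using nonempty_Basis by blast
    then have "b \<in> sphere (0 :: 'v) 1" by simp
    then have "sphere (0 :: 'v) 1 \<noteq> {}" by blast
    moreover have "continuous_on (sphere 0 1) r" by (rule continuous_on_subset[OF r_cont]) simp
    ultimately have "\<exists>z\<in>sphere 0 1. \<forall>x\<in>sphere 0 1. r z \<le> r x"
      by (rule continuous_attains_inf[OF compact_sphere])
    then obtain z where z: "z \<in> sphere 0 1" "\<And>x. x \<in> sphere 0 1 \<Longrightarrow> r z \<le> r x"
      by blast
    have "r z \<noteq> 0" using z(1) by (auto simp: r_0_iff)
    then have "0 < r z" using r_nonneg[of z] by simp
    then show ?thesis using z(2) that[of "r z"] by simp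
  qed
  \<comment> \<open>a point outside the unit ball is dilated onto the sphere by some \<open>t \<le> 1\<close>, so its norm is at least \<open>c\<close>\<close>
  have U_c: "U c \<subseteq> ball 0 1"
  proof
    fix x assume x: "x \<in> U c"
    show "x \<in> ball 0 1"
    proof (rule ccontr)
      assume "x \<notin> ball 0 1"
      then have "1 \<le> norm x" by simp
      moreover have "continuous_on {0..1} (\<lambda>t. norm (dil t x))"
        unfolding dil_def by (intro continuous_intros)
      ultimately obtain t where t: "0 \<le> t" "t \<le> 1" "norm (dil t x) = 1"
        using IVT'[of "\<lambda>t. norm (dil t x)" 0 1 1] by (auto simp: dil_0 dil_1)
      then have "0 < t" using dil_0 by (cases "t = 0") auto
      have "c \<le> t * r x" using c(2)[OF t(3)] r_dil[OF \<open>0 < t\<close>] by simp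
      also have "\<dots> \<le> r x" using t(2) r_nonneg[of x] by (simp add: mult_left_le_one_le t(1))
      finally show False using x by (simp add: U_def)
    qed
  qed
  have U_finite: "emeasure lborel (U R) < \<infinity>" for R
  proof -
    have "bounded (dil ((\<bar>R\<bar> + 1) / c) ` U c)"
      using linear_dil bounded_subset[OF bounded_ball U_c]
      by (intro bounded_linear_image) (simp_all add: linear_conv_bounded_linear)
    then have "bounded (U (\<bar>R\<bar> + 1))" using c(1) by (simp add: dil_U)
    then have "bounded (U R)" by (rule bounded_subset) (auto simp: U_def)
    then show ?thesis by (rule emeasure_bounded_finite)
  qed
  have U_pos: "0 < emeasure lborel (U R)" if "0 < R" for R
  proof -
    have "0 \<in> U R" using that r_0_iff[of 0] by (simp add: U_def)
    then obtain e where e: "0 < e" "ball 0 e \<subseteq> U R" using U_open[of R] open_contains_ball by blast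
    have "0 < emeasure lborel (ball (0 :: 'v) e)"
      using content_ball_pos[OF e(1), of "0 :: 'v"] by (auto simp: measure_def zero_less_iff_neq_zero)
    also have "\<dots> \<le> emeasure lborel (U R)" using e(2) U_borel by (intro emeasure_mono) auto
    finally show ?thesis .
  qed
  define d where "d g h = \<rho> (inv g \<otimes> h)" for g h
  have d_exp: "d (expG x) (expG y) = r (chart_mult (- x) y)" for x y
    by (simp add: d_def r_def inv_exp exp_chart_mult)
  have ball: "{h \<in> space (haar expG). d (expG x) h < R} = expG ` (chart_mult x ` U R)" for x R
    unfolding left_translation_image space_haar range_exp[symmetric] by (auto simp: d_exp U_def)
  have translate_borel: "chart_mult x ` U R \<in> sets borel" for x R
    unfolding left_translation_image
    using open_vimage[OF U_open left_translation_continuous] by simp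
  have ball_measure: "emeasure (haar expG) {h \<in> space (haar expG). d (expG x) h < R} = emeasure lborel (U R)"
    for x R
    unfolding ball emeasure_haar_image(2)[OF translate_borel]
    by (rule left_translation_preserves_lborel[OF U_borel U_finite])
  define K where "K = max 1 \<bar>linear_det (dil 2)\<bar>"
  have double: "emeasure lborel (U (2 * R)) \<le> ennreal K * emeasure lborel (U R)" for R
  proof -
    have "emeasure lborel (U (2 * R)) = ennreal \<bar>linear_det (dil 2)\<bar> * emeasure lborel (U R)"
      using emeasure_dil[OF U_borel U_finite, of 2 R] by (simp add: dil_U)
    also have "\<dots> \<le> ennreal K * emeasure lborel (U R)"
      by (intro mult_right_mono ennreal_leI) (auto simp: K_def)
    finally show ?thesis .
  qed
  obtain D :: "'v set" where D: "countable D" "\<And>X. open X \<Longrightarrow> X \<noteq> {} \<Longrightarrow> \<exists>q\<in>D. q \<in> X"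
    using countable_dense_setE by blast
  have "doubling_space (haar expG) d (expG ` D) K"
  proof
    fix g assume "g \<in> space (haar expG)"
    then obtain x where x: "g = expG x" by (auto simp: space_haar range_exp[symmetric])
    show "d g g = 0" using r_0_iff[of 0] by (simp add: x d_exp)
    show "{h \<in> space (haar expG). d g h < R} \<in> sets (haar expG)" for R
      unfolding x ball by (rule emeasure_haar_image(1)[OF translate_borel])
    show "emeasure (haar expG) {h \<in> space (haar expG). d g h < R} < \<infinity>" for R
      unfolding x ball_measure by (rule U_finite)
    {
      fix R :: real assume "0 < R"
      then show "0 < emeasure (haar expG) {h \<in> space (haar expG). d g h < R}"
        unfolding x ball_measure by (rule U_pos)
      show "emeasure (haar expG) {h \<in> space (haar expG). d g h < 2 * R}
          \<le> ennreal K * emeasure (haar expG) {h \<in> space (haar expG). d g h < R}"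
        unfolding x ball_measure by (rule double)
      have "chart_mult x 0 \<in> chart_mult x ` U R"
        using \<open>0 < R\<close> r_0_iff[of 0] by (intro imageI) (simp add: U_def)
      moreover have "open (chart_mult x ` U R)"
        unfolding left_translation_image by (rule open_vimage[OF U_open left_translation_continuous])
      ultimately obtain q where q: "q \<in> D" "q \<in> chart_mult x ` U R" using D(2) by blast
      then have "d (expG x) (expG q) < R"
        unfolding left_translation_image by (simp add: d_exp U_def)
      then show "\<exists>q\<in>expG ` D. d g q < R" using q(1) unfolding x by blast
    }
    fix h assume "h \<in> space (haar expG)"
    then obtain y where y: "h = expG y" by (auto simp: space_haar range_exp[symmetric])
    have "- chart_mult (- x) y = chart_mult (- y) x" by (simp add: minus_m)
    then show "d g h = d h g" using r_minus[of "chart_mult (- x) y"] by (simp add: x y d_exp)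
    fix k assume "k \<in> space (haar expG)"
    then obtain z where z: "k = expG z" by (auto simp: space_haar range_exp[symmetric])
    have "chart_mult (- x) z = chart_mult (chart_mult (- x) y) (chart_mult (- y) z)" by (simp add: assoc)
    then show "d g k \<le> d g h + d h k"
      using r_add[of "chart_mult (- x) y" "chart_mult (- y) z"] by (simp add: x y z d_exp)
  qed (use D in \<open>auto simp: K_def space_haar\<close>)
  then show ?thesis unfolding d_def[abs_def] by blast
qed

end

section \<open>The strong maximal function\<close>

locale doubling_pair = X: doubling_space M1 d1 D1 K1 + Y: doubling_space M2 d2 D2 K2
  for M1 :: "'a measure" and d1 D1 K1 and M2 :: "'b measure" and d2 D2 K2
begin

sublocale pair_sigma_finite M1 M2
  by (intro pair_sigma_finite.intro X.sigma_finite Y.sigma_finite)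

definition maximal_fst :: "('a \<times> 'b \<Rightarrow> ennreal) \<Rightarrow> 'a \<times> 'b \<Rightarrow> ennreal" where
  "maximal_fst f = (\<lambda>(x, y). X.maximal (\<lambda>x'. f (x', y)) x)"

definition maximal_snd :: "('a \<times> 'b \<Rightarrow> ennreal) \<Rightarrow> 'a \<times> 'b \<Rightarrow> ennreal" where
  "maximal_snd f = (\<lambda>(x, y). Y.maximal (\<lambda>y'. f (x, y')) y)"

lemma maximal_fst_measurable [measurable]:
  assumes "f \<in> borel_measurable (M1 \<Otimes>\<^sub>M M2)"
  shows "maximal_fst f \<in> borel_measurable (M1 \<Otimes>\<^sub>M M2)"
  unfolding maximal_fst_def by (rule X.maximal_slice_measurable) (use assms in simp)

lemma maximal_snd_measurable [measurable]:
  assumes "f \<in> borel_measurable (M1 \<Otimes>\<^sub>M M2)"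
  shows "maximal_snd f \<in> borel_measurable (M1 \<Otimes>\<^sub>M M2)"
proof -
  have "(\<lambda>(y, x). f (x, y)) \<in> borel_measurable (M2 \<Otimes>\<^sub>M M1)"
    using measurable_pair_swap[OF assms] by simp
  then have "(\<lambda>(y, x). Y.maximal (\<lambda>y'. f (x, y')) y) \<in> borel_measurable (M2 \<Otimes>\<^sub>M M1)"
    by (rule Y.maximal_slice_measurable)
  from measurable_pair_swap[OF this] show ?thesis
    by (simp add: maximal_snd_def)
qed

text \<open>For fixed \<open>x\<close>, the truncated weak type inequality in \<open>y\<close> bounds the measure of a slice by an integral of
\<open>maximal_fst f\<close> over the set where it exceeds \<open>t / 2\<close>.  After exchanging the integrals, \<open>llogl_dyadic\<close>
applies in \<open>x\<close> for fixed \<open>y\<close>.\<close>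
lemma iterated_maximal_weak_type:
  assumes f[measurable]: "f \<in> borel_measurable (M1 \<Otimes>\<^sub>M M2)" and "0 < t"
  shows "ennreal t * emeasure (M1 \<Otimes>\<^sub>M M2) {z \<in> space (M1 \<Otimes>\<^sub>M M2). ennreal t < maximal_snd (maximal_fst f) z}
    \<le> ennreal (8 * K1\<^sup>2 * K2\<^sup>2) *
      (\<integral>\<^sup>+z. f z * (\<Sum>k. indicator {y. ennreal (2 ^ k * (t / 2) / 2) < y} (f z)) \<partial>(M1 \<Otimes>\<^sub>M M2))"
proof -
  define N where "N = maximal_fst f"
  have N[measurable]: "N \<in> borel_measurable (M1 \<Otimes>\<^sub>M M2)" unfolding N_def by measurable
  define E where "E = {z \<in> space (M1 \<Otimes>\<^sub>M M2). ennreal t < maximal_snd N z}"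
  have E[measurable]: "E \<in> sets (M1 \<Otimes>\<^sub>M M2)" unfolding E_def by measurable
  define h where "h z = N z * indicator {y. ennreal (t / 2) < y} (N z)" for z
  have h[measurable]: "h \<in> borel_measurable (M1 \<Otimes>\<^sub>M M2)"
    unfolding h_def[abs_def] using indicator_superlevel_measurable[OF N] N by measurable
  define S where "S u = u * (\<Sum>k. indicator {y. ennreal (2 ^ k * (t / 2) / 2) < y} u)" for u :: ennreal
  have Sf: "(\<lambda>z. S (f z)) \<in> borel_measurable (M1 \<Otimes>\<^sub>M M2)"
    unfolding S_def using indicator_superlevel_measurable[OF f] f by measurable
  have slice: "ennreal t * emeasure M2 (Pair x -` E) \<le> ennreal (2 * K2\<^sup>2) * (\<integral>\<^sup>+y. h (x, y) \<partial>M2)"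
    if x: "x \<in> space M1" for x
  proof -
    have Nx: "(\<lambda>y. N (x, y)) \<in> borel_measurable M2" using x by measurable
    have "Pair x -` E = {y \<in> space M2. ennreal t < Y.maximal (\<lambda>y. N (x, y)) y}"
      using x by (auto simp: E_def maximal_snd_def space_pair_measure)
    then have "ennreal t * emeasure M2 (Pair x -` E)
        \<le> ennreal (2 * K2\<^sup>2) * (\<integral>\<^sup>+y. N (x, y) * indicator {y. ennreal (t / 2) < N (x, y)} y \<partial>M2)"
      using Y.weak_type_truncated[OF Nx, of t] \<open>0 < t\<close> by simp
    also have "(\<lambda>y. N (x, y) * indicator {y. ennreal (t / 2) < N (x, y)} y) = (\<lambda>y. h (x, y))"
      by (simp add: h_def indicator_def)
    finally show ?thesis .
  qed
  have slice': "(\<integral>\<^sup>+x. h (x, y) \<partial>M1) \<le> ennreal (4 * K1\<^sup>2) * (\<integral>\<^sup>+x. S (f (x, y)) \<partial>M1)"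
    if y: "y \<in> space M2" for y
  proof -
    have fy: "(\<lambda>x. f (x, y)) \<in> borel_measurable M1" using y by measurable
    show ?thesis
      using X.llogl_dyadic[OF fy, of "t / 2"] \<open>0 < t\<close>
      unfolding h_def N_def maximal_fst_def S_def prod.case by simp
  qed
  have "ennreal t * emeasure (M1 \<Otimes>\<^sub>M M2) E = (\<integral>\<^sup>+x. ennreal t * emeasure M2 (Pair x -` E) \<partial>M1)"
    unfolding M2.emeasure_pair_measure_alt[OF E]
    by (rule nn_integral_cmult[symmetric]) (rule M2.measurable_emeasure_Pair[OF E])
  also have "\<dots> \<le> (\<integral>\<^sup>+x. ennreal (2 * K2\<^sup>2) * (\<integral>\<^sup>+y. h (x, y) \<partial>M2) \<partial>M1)"
    by (intro nn_integral_mono slice)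
  also have "\<dots> = ennreal (2 * K2\<^sup>2) * (\<integral>\<^sup>+x. (\<integral>\<^sup>+y. h (x, y) \<partial>M2) \<partial>M1)"
    by (rule nn_integral_cmult) measurable
  also have "(\<integral>\<^sup>+x. (\<integral>\<^sup>+y. h (x, y) \<partial>M2) \<partial>M1) = (\<integral>\<^sup>+y. (\<integral>\<^sup>+x. h (x, y) \<partial>M1) \<partial>M2)"
    by (rule Fubini'[symmetric]) simp
  also have "\<dots> \<le> (\<integral>\<^sup>+y. ennreal (4 * K1\<^sup>2) * (\<integral>\<^sup>+x. S (f (x, y)) \<partial>M1) \<partial>M2)"
    by (intro nn_integral_mono slice')
  also have "\<dots> = ennreal (4 * K1\<^sup>2) * (\<integral>\<^sup>+y. (\<integral>\<^sup>+x. S (f (x, y)) \<partial>M1) \<partial>M2)"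
    by (rule nn_integral_cmult) (use Sf in measurable)
  also have "(\<integral>\<^sup>+y. (\<integral>\<^sup>+x. S (f (x, y)) \<partial>M1) \<partial>M2) = (\<integral>\<^sup>+z. S (f z) \<partial>(M1 \<Otimes>\<^sub>M M2))"
    by (rule nn_integral_snd[OF Sf])
  also have "ennreal (2 * K2\<^sup>2) * (ennreal (4 * K1\<^sup>2) * (\<integral>\<^sup>+z. S (f z) \<partial>(M1 \<Otimes>\<^sub>M M2)))
      = ennreal (8 * K1\<^sup>2 * K2\<^sup>2) * (\<integral>\<^sup>+z. S (f z) \<partial>(M1 \<Otimes>\<^sub>M M2))"
    unfolding mult.assoc[symmetric] by (subst ennreal_mult[symmetric]) (simp_all add: mult_ac)
  finally show ?thesis
    unfolding E_def N_def S_def by (simp add: mult_left_mono)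
qed

text \<open>The level \<open>lam / \<kappa>\<close> leaves room for the loss \<open>\<kappa> = K1 * K2\<close> in the comparison of the strong maximal function
with the iterated one.\<close>
lemma iterated_maximal_llogl:
  fixes u :: "'a \<times> 'b \<Rightarrow> real"
  assumes u[measurable]: "u \<in> borel_measurable (M1 \<Otimes>\<^sub>M M2)" and nonneg: "\<And>z. 0 \<le> u z"
    and lam: "0 < lam" and \<kappa>: "1 \<le> \<kappa>"
  shows "emeasure (M1 \<Otimes>\<^sub>M M2) {z \<in> space (M1 \<Otimes>\<^sub>M M2).
      ennreal (lam / \<kappa>) < maximal_snd (maximal_fst (\<lambda>z. ennreal (u z))) z}
    \<le> ennreal (8 * K1\<^sup>2 * K2\<^sup>2 * \<kappa> * (log 2 \<kappa> + 5)) *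
      (\<integral>\<^sup>+z. ennreal (Phi (u z / lam)) \<partial>(M1 \<Otimes>\<^sub>M M2))"
proof -
  define E where "E = {z \<in> space (M1 \<Otimes>\<^sub>M M2).
      ennreal (lam / \<kappa>) < maximal_snd (maximal_fst (\<lambda>z. ennreal (u z))) z}"
  define t where "t = lam / \<kappa>"
  define L where "L = log 2 \<kappa> + 5"
  have t: "0 < t" using lam \<kappa> by (simp add: t_def)
  have L: "0 \<le> L" using \<kappa> by (simp add: L_def)
  have point: "ennreal (u z) * (\<Sum>k. indicator {y. ennreal (2 ^ k * (t / 2) / 2) < y} (ennreal (u z)))
      \<le> ennreal (lam * L) * ennreal (Phi (u z / lam))" for z
  proof -
    have "ennreal (u z) * (\<Sum>k. indicator {y. ennreal (2 ^ k * (t / 2) / 2) < y} (ennreal (u z)))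
        \<le> ennreal (u z) * ennreal (L * ln (exp 1 + u z / lam))"
      unfolding t_def L_def by (intro mult_left_mono dyadic_count_le_log nonneg lam \<kappa>) simp
    also have "\<dots> = ennreal (u z * (L * ln (exp 1 + u z / lam)))"
      by (rule ennreal_mult'[symmetric]) (rule nonneg)
    also have "u z * (L * ln (exp 1 + u z / lam)) = (lam * L) * Phi (u z / lam)"
      using lam by (simp add: Phi_def)
    also have "ennreal \<dots> = ennreal (lam * L) * ennreal (Phi (u z / lam))"
      using lam L by (intro ennreal_mult') simp
    finally show ?thesis .
  qed
  have Phi_meas: "(\<lambda>z. ennreal (Phi (u z / lam))) \<in> borel_measurable (M1 \<Otimes>\<^sub>M M2)"
    unfolding Phi_def by measurable
  have "ennreal t * emeasure (M1 \<Otimes>\<^sub>M M2) E \<le> ennreal (8 * K1\<^sup>2 * K2\<^sup>2) *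
      (\<integral>\<^sup>+z. ennreal (u z) * (\<Sum>k. indicator {y. ennreal (2 ^ k * (t / 2) / 2) < y} (ennreal (u z))) \<partial>(M1 \<Otimes>\<^sub>M M2))"
    unfolding E_def t_def[symmetric] by (rule iterated_maximal_weak_type[OF _ t]) measurable
  also have "\<dots> \<le> ennreal (8 * K1\<^sup>2 * K2\<^sup>2) *
      (\<integral>\<^sup>+z. ennreal (lam * L) * ennreal (Phi (u z / lam)) \<partial>(M1 \<Otimes>\<^sub>M M2))"
    by (intro mult_left_mono nn_integral_mono point) simp
  also have "\<dots> = ennreal (8 * K1\<^sup>2 * K2\<^sup>2) * (ennreal (lam * L) *
      (\<integral>\<^sup>+z. ennreal (Phi (u z / lam)) \<partial>(M1 \<Otimes>\<^sub>M M2)))"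
    by (subst nn_integral_cmult[OF Phi_meas]) (rule refl)
  finally have le: "ennreal t * emeasure (M1 \<Otimes>\<^sub>M M2) E \<le> \<dots>" .
  have "emeasure (M1 \<Otimes>\<^sub>M M2) E = ennreal (1 / t) * (ennreal t * emeasure (M1 \<Otimes>\<^sub>M M2) E)"
    using t by (simp add: mult.assoc[symmetric] ennreal_mult[symmetric])
  also have "\<dots> \<le> ennreal (1 / t) * (ennreal (8 * K1\<^sup>2 * K2\<^sup>2) * (ennreal (lam * L) *
      (\<integral>\<^sup>+z. ennreal (Phi (u z / lam)) \<partial>(M1 \<Otimes>\<^sub>M M2))))"
    by (rule mult_left_mono[OF le]) simp
  also have "\<dots> = ennreal (1 / t * (8 * K1\<^sup>2 * K2\<^sup>2) * (lam * L)) *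
      (\<integral>\<^sup>+z. ennreal (Phi (u z / lam)) \<partial>(M1 \<Otimes>\<^sub>M M2))"
  proof -
    have "ennreal (a * b * c) = ennreal a * ennreal b * ennreal c" if "0 \<le> a" "0 \<le> b" "0 \<le> c" for a b c
      using that by (simp add: ennreal_mult)
    from this[of "1 / t" "8 * K1\<^sup>2 * K2\<^sup>2" "lam * L"]
    have "ennreal (1 / t * (8 * K1\<^sup>2 * K2\<^sup>2) * (lam * L))
        = ennreal (1 / t) * ennreal (8 * K1\<^sup>2 * K2\<^sup>2) * ennreal (lam * L)"
      using t lam L by simp
    then show ?thesis by (simp only: mult.assoc)
  qed
  also have "1 / t * (8 * K1\<^sup>2 * K2\<^sup>2) * (lam * L) = 8 * K1\<^sup>2 * K2\<^sup>2 * \<kappa> * (log 2 \<kappa> + 5)"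
    using lam \<kappa> by (simp add: t_def L_def)
  finally show ?thesis unfolding E_def .
qed

text \<open>Integrate first over \<open>x\<close>, where for each \<open>y\<close> the average is at most \<open>K1\<close> times the maximal function at
\<open>fst g\<close>; the result is then averaged over \<open>y\<close>.\<close>
lemma rectangle_integral_le:
  assumes f[measurable]: "f \<in> borel_measurable (M1 \<Otimes>\<^sub>M M2)"
    and x: "x1 \<in> space M1" "0 < r1" "x2 \<in> space M2" "0 < r2"
    and g: "g \<in> X.dball x1 r1 \<times> Y.dball x2 r2"
  shows "(\<integral>\<^sup>+z. f z * indicator (X.dball x1 r1 \<times> Y.dball x2 r2) z \<partial>(M1 \<Otimes>\<^sub>M M2))
    \<le> ennreal (K1 * K2) * emeasure (M1 \<Otimes>\<^sub>M M2) (X.dball x1 r1 \<times> Y.dball x2 r2) * maximal_snd (maximal_fst f) g"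
proof -
  obtain a b where ab: "g = (a, b)" "a \<in> X.dball x1 r1" "b \<in> Y.dball x2 r2" using g by auto
  have a: "a \<in> space M1" using ab(2) X.dball_subset_space by blast
  define A where "A = X.dball x1 r1"
  define B where "B = Y.dball x2 r2"
  have [measurable]: "A \<in> sets M1" "B \<in> sets M2" using x by (auto simp: A_def B_def)
  define N where "N = maximal_fst f"
  have [measurable]: "N \<in> borel_measurable (M1 \<Otimes>\<^sub>M M2)" unfolding N_def by measurable
  have "(\<integral>\<^sup>+z. f z * indicator (A \<times> B) z \<partial>(M1 \<Otimes>\<^sub>M M2))
      = (\<integral>\<^sup>+y. (\<integral>\<^sup>+x. f (x, y) * indicator (A \<times> B) (x, y) \<partial>M1) \<partial>M2)"
    by (rule nn_integral_snd[symmetric]) measurable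
  also have "\<dots> \<le> (\<integral>\<^sup>+y. ennreal K1 * emeasure M1 A * (N (a, y) * indicator B y) \<partial>M2)"
  proof (rule nn_integral_mono)
    fix y assume "y \<in> space M2"
    have "(\<integral>\<^sup>+x. f (x, y) * indicator A x \<partial>M1) \<le> ennreal K1 * emeasure M1 A * N (a, y)"
      using X.ball_integral_le_maximal[OF x(1,2) ab(2), of "\<lambda>x. f (x, y)"]
      unfolding N_def maximal_fst_def A_def by simp
    then show "(\<integral>\<^sup>+x. f (x, y) * indicator (A \<times> B) (x, y) \<partial>M1)
        \<le> ennreal K1 * emeasure M1 A * (N (a, y) * indicator B y)"
      by (cases "y \<in> B") (simp_all add: indicator_times)
  qed
  also have "\<dots> = ennreal K1 * emeasure M1 A * (\<integral>\<^sup>+y. N (a, y) * indicator B y \<partial>M2)"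
    by (rule nn_integral_cmult) (use a in measurable)
  also have "\<dots> \<le> ennreal K1 * emeasure M1 A * (ennreal K2 * emeasure M2 B * maximal_snd N (a, b))"
    using Y.ball_integral_le_maximal[OF x(3,4) ab(3), of "\<lambda>y. N (a, y)"]
    unfolding B_def maximal_snd_def by (intro mult_left_mono) simp_all
  also have "\<dots> = (ennreal K1 * ennreal K2) * (emeasure M1 A * emeasure M2 B) * maximal_snd N g"
    by (simp add: ab(1) mult_ac)
  also have "\<dots> = ennreal (K1 * K2) * emeasure (M1 \<Otimes>\<^sub>M M2) (A \<times> B) * maximal_snd N g"
    using X.K_ge_1 Y.K_ge_1 by (simp add: ennreal_mult M2.emeasure_pair_measure_Times)
  finally show ?thesis unfolding A_def B_def N_def .
qed

text \<open>By \<open>rational_ball_inside\<close> the union is also the union of those products of balls of the two countable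
families that are contained in some member of \<open>\<P>\<close>.\<close>
lemma union_of_rectangles_measurable:
  assumes "\<And>P. P \<in> \<P> \<Longrightarrow> \<exists>x1\<in>space M1. \<exists>r1. \<exists>x2\<in>space M2. \<exists>r2. P = X.dball x1 r1 \<times> Y.dball x2 r2"
  shows "\<Union>\<P> \<in> sets (M1 \<Otimes>\<^sub>M M2)"
proof -
  define C where "C = (D1 \<times> (\<rat> \<inter> {0::real<..})) \<times> (D2 \<times> (\<rat> \<inter> {0::real<..}))"
  define R where "R = (\<lambda>((q1, s1), (q2, s2)). X.dball q1 s1 \<times> Y.dball q2 s2)"
  have "countable C"
    unfolding C_def by (intro countable_SIGMA X.countable_rational_balls Y.countable_rational_balls)
  then have cC: "countable {c \<in> C. \<exists>P\<in>\<P>. R c \<subseteq> P}" by (rule countable_subset[rotated]) blast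
  have R: "R c \<in> sets (M1 \<Otimes>\<^sub>M M2)" if "c \<in> C" for c
    using that X.centres_subset Y.centres_subset
    by (auto simp: C_def R_def intro!: X.dball_sets Y.dball_sets)
  have "\<Union>\<P> = (\<Union>c\<in>{c \<in> C. \<exists>P\<in>\<P>. R c \<subseteq> P}. R c)"
  proof
    show "\<Union>\<P> \<subseteq> (\<Union>c\<in>{c \<in> C. \<exists>P\<in>\<P>. R c \<subseteq> P}. R c)"
    proof
      fix g assume "g \<in> \<Union>\<P>"
      then obtain P where P: "P \<in> \<P>" "g \<in> P" by blast
      then obtain x1 r1 x2 r2 where x: "x1 \<in> space M1" "x2 \<in> space M2" "P = X.dball x1 r1 \<times> Y.dball x2 r2"
        using assms by blast
      obtain a b where g: "g = (a, b)" "a \<in> X.dball x1 r1" "b \<in> Y.dball x2 r2" using P(2) x(3) by auto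
      obtain q1 s1 where 1: "q1 \<in> D1" "s1 \<in> \<rat> \<inter> {0<..}" "a \<in> X.dball q1 s1" "X.dball q1 s1 \<subseteq> X.dball x1 r1"
        using X.rational_ball_inside[OF x(1) g(2)] by blast
      obtain q2 s2 where 2: "q2 \<in> D2" "s2 \<in> \<rat> \<inter> {0<..}" "b \<in> Y.dball q2 s2" "Y.dball q2 s2 \<subseteq> Y.dball x2 r2"
        using Y.rational_ball_inside[OF x(2) g(3)] by blast
      have "((q1, s1), (q2, s2)) \<in> C" using 1 2 by (simp add: C_def)
      moreover have "R ((q1, s1), (q2, s2)) \<subseteq> P" using 1(4) 2(4) x(3) by (auto simp: R_def)
      moreover have "g \<in> R ((q1, s1), (q2, s2))" using g(1) 1(3) 2(3) by (simp add: R_def)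
      ultimately show "g \<in> (\<Union>c\<in>{c \<in> C. \<exists>P\<in>\<P>. R c \<subseteq> P}. R c)" using P(1) by blast
    qed
  qed blast
  moreover have "(\<Union>c\<in>{c \<in> C. \<exists>P\<in>\<P>. R c \<subseteq> P}. R c) \<in> sets (M1 \<Otimes>\<^sub>M M2)"
    by (rule sets.countable_UN'[OF cC]) (use R in blast)
  ultimately show ?thesis by simp
qed

end

theorem theorem3p3:
  fixes G1 :: "('g::topological_space, 'b) monoid_scheme"
    and exp1 :: "'v::euclidean_space \<Rightarrow> 'g" and s1 :: nat and V1 :: "nat \<Rightarrow> 'v set"
    and \<rho>1 :: "'g \<Rightarrow> real"
    and G2 :: "('h::topological_space, 'c) monoid_scheme"
    and exp2 :: "'w::euclidean_space \<Rightarrow> 'h" and s2 :: nat and V2 :: "nat \<Rightarrow> 'w set"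
    and \<rho>2 :: "'h \<Rightarrow> real"
  assumes "normed_stratified_group G1 exp1 s1 V1 \<rho>1"
    and "normed_stratified_group G2 exp2 s2 V2 \<rho>2"
  shows "\<exists>C::real. 0 < C \<and>
    (\<forall>lam::real. 0 < lam \<longrightarrow> (\<forall>f \<in> L_log_L G1 exp1 G2 exp2.
       let E = {g \<in> carrier G1 \<times> carrier G2.
                  strong_maximal G1 exp1 \<rho>1 G2 exp2 \<rho>2 f g > ennreal lam}
       in E \<in> sets (prod_haar exp1 exp2) \<and>
          emeasure (prod_haar exp1 exp2) E
            \<le> ennreal C * F_Phi exp1 exp2 (\<lambda>g. f g / lam)))"
proof -
  interpret G1: normed_stratified_group G1 exp1 s1 V1 \<rho>1 by fact
  interpret G2: normed_stratified_group G2 exp2 s2 V2 \<rho>2 by fact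
  obtain D1 K1 where D1: "doubling_space (haar exp1) (\<lambda>g h. \<rho>1 (inv\<^bsub>G1\<^esub> g \<otimes>\<^bsub>G1\<^esub> h)) D1 K1"
    using G1.haar_doubling_space by blast
  obtain D2 K2 where D2: "doubling_space (haar exp2) (\<lambda>g h. \<rho>2 (inv\<^bsub>G2\<^esub> g \<otimes>\<^bsub>G2\<^esub> h)) D2 K2"
    using G2.haar_doubling_space by blast
  interpret doubling_pair "haar exp1" "\<lambda>g h. \<rho>1 (inv\<^bsub>G1\<^esub> g \<otimes>\<^bsub>G1\<^esub> h)" D1 K1
      "haar exp2" "\<lambda>g h. \<rho>2 (inv\<^bsub>G2\<^esub> g \<otimes>\<^bsub>G2\<^esub> h)" D2 K2
    by (intro doubling_pair.intro D1 D2)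
  let ?M = "haar exp1 \<Otimes>\<^sub>M haar exp2"
  define \<kappa> where "\<kappa> = K1 * K2"
  have \<kappa>: "1 \<le> \<kappa>"
    using mult_mono[OF X.K_ge_1 Y.K_ge_1] X.K_ge_1 by (simp add: \<kappa>_def)
  define C where "C = 8 * K1\<^sup>2 * K2\<^sup>2 * \<kappa> * (log 2 \<kappa> + 5)"
  have C: "0 < C"
  proof -
    have "0 < log 2 \<kappa> + 5" using \<kappa> by (simp add: add_nonneg_pos)
    then show ?thesis
      unfolding C_def using \<kappa> X.K_ge_1 Y.K_ge_1 by (intro mult_pos_pos zero_less_power) auto
  qed
  have ball1: "group_ball G1 \<rho>1 x r = X.dball x r" for x r
    by (simp add: group_ball_def X.dball_def G1.space_haar)
  have ball2: "group_ball G2 \<rho>2 x r = Y.dball x r" for x r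
    by (simp add: group_ball_def Y.dball_def G2.space_haar)
  have main: "{g \<in> carrier G1 \<times> carrier G2. strong_maximal G1 exp1 \<rho>1 G2 exp2 \<rho>2 f g > ennreal lam}
        \<in> sets (prod_haar exp1 exp2) \<and>
      emeasure (prod_haar exp1 exp2) {g \<in> carrier G1 \<times> carrier G2.
          strong_maximal G1 exp1 \<rho>1 G2 exp2 \<rho>2 f g > ennreal lam}
        \<le> ennreal C * F_Phi exp1 exp2 (\<lambda>g. f g / lam)"
    if lam: "0 < lam" and f: "f \<in> borel_measurable (prod_haar exp1 exp2)" for lam :: real and f
  proof -
    define E where "E = {g \<in> carrier G1 \<times> carrier G2.
      strong_maximal G1 exp1 \<rho>1 G2 exp2 \<rho>2 f g > ennreal lam}"
    define avg where "avg P = (\<integral>\<^sup>+ h \<in> P. ennreal \<bar>f h\<bar> \<partial>prod_haar exp1 exp2) / emeasure (prod_haar exp1 exp2) P" for P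
    define \<P> where "\<P> = {X.dball x1 r1 \<times> Y.dball x2 r2 |x1 r1 x2 r2.
      x1 \<in> carrier G1 \<and> 0 < r1 \<and> x2 \<in> carrier G2 \<and> 0 < r2 \<and> ennreal lam < avg (X.dball x1 r1 \<times> Y.dball x2 r2)}"
    \<comment> \<open>Every point of a rectangle with large average lies in \<open>E\<close>.\<close>
    have E_eq: "E = \<Union>\<P>"
    proof
      show "E \<subseteq> \<Union>\<P>"
        unfolding E_def strong_maximal_def ball1 ball2 avg_def[symmetric] less_SUP_iff \<P>_def by blast
      show "\<Union>\<P> \<subseteq> E"
      proof
        fix g assume "g \<in> \<Union>\<P>"
        then obtain x1 r1 x2 r2 where *: "x1 \<in> carrier G1" "0 < r1" "x2 \<in> carrier G2" "0 < r2"
          "ennreal lam < avg (X.dball x1 r1 \<times> Y.dball x2 r2)" "g \<in> X.dball x1 r1 \<times> Y.dball x2 r2"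
          unfolding \<P>_def by blast
        have "g \<in> carrier G1 \<times> carrier G2"
          using *(6) X.dball_subset_space[of x1 r1] Y.dball_subset_space[of x2 r2]
          by (auto simp: G1.space_haar G2.space_haar)
        then show "g \<in> E"
          unfolding E_def strong_maximal_def ball1 ball2 avg_def[symmetric] less_SUP_iff
          using * by blast
      qed
    qed
    have E_sets: "E \<in> sets ?M"
      unfolding E_eq
    proof (rule union_of_rectangles_measurable)
      fix P assume "P \<in> \<P>"
      then show "\<exists>x1\<in>space (haar exp1). \<exists>r1. \<exists>x2\<in>space (haar exp2). \<exists>r2. P = X.dball x1 r1 \<times> Y.dball x2 r2"
        unfolding \<P>_def G1.space_haar G2.space_haar by blast
    qed
    \<comment> \<open>Averages and \<open>F_Phi\<close> only depend on \<open>f\<close> up to null sets, so \<open>f\<close> may be taken measurable before completion.\<close>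
    obtain f' where f'[measurable]: "f' \<in> borel_measurable ?M" and ae: "AE g in ?M. f g = f' g"
      using completion_ex_borel_measurable_real[of f ?M] f unfolding prod_haar_def by blast
    define N where "N = maximal_snd (maximal_fst (\<lambda>g. ennreal \<bar>f' g\<bar>))"
    have "E \<subseteq> {z \<in> space ?M. ennreal (lam / \<kappa>) < N z}"
    proof
      fix g assume "g \<in> E"
      then obtain x1 r1 x2 r2 where *: "x1 \<in> carrier G1" "0 < r1" "x2 \<in> carrier G2" "0 < r2"
        "ennreal lam < avg (X.dball x1 r1 \<times> Y.dball x2 r2)" "g \<in> X.dball x1 r1 \<times> Y.dball x2 r2"
        unfolding E_eq \<P>_def by blast
      define P where "P = X.dball x1 r1 \<times> Y.dball x2 r2"
      have x: "x1 \<in> space (haar exp1)" "x2 \<in> space (haar exp2)" using * by (simp_all add: G1.space_haar G2.space_haar)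
      have P_sets: "P \<in> sets ?M" unfolding P_def using x by simp
      have P_measure: "emeasure ?M P = emeasure (haar exp1) (X.dball x1 r1) * emeasure (haar exp2) (Y.dball x2 r2)"
        unfolding P_def using x by (intro M2.emeasure_pair_measure_Times) auto
      have P_pos: "emeasure ?M P \<noteq> 0" "emeasure ?M P \<noteq> \<infinity>"
        unfolding P_measure
        using X.dball_measure[OF x(1) *(2)] Y.dball_measure[OF x(2) *(4)]
        by (auto simp: ennreal_mult_eq_top_iff)
      have "(\<integral>\<^sup>+ h. ennreal \<bar>f h\<bar> * indicator P h \<partial>?M) = (\<integral>\<^sup>+ h. ennreal \<bar>f' h\<bar> * indicator P h \<partial>?M)"
        by (rule nn_integral_cong_AE) (use ae in \<open>auto elim!: eventually_mono\<close>)
      also have "\<dots> \<le> ennreal (K1 * K2) * emeasure ?M P * N g"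
        unfolding P_def N_def by (rule rectangle_integral_le[OF _ x(1) *(2) x(2) *(4,6)]) measurable
      finally have int_le: "(\<integral>\<^sup>+ h. ennreal \<bar>f h\<bar> * indicator P h \<partial>?M) \<le> ennreal \<kappa> * N g * emeasure ?M P"
        by (simp add: \<kappa>_def mult_ac)
      have "ennreal lam < (\<integral>\<^sup>+ h. ennreal \<bar>f h\<bar> * indicator P h \<partial>?M) / emeasure ?M P"
        using *(5) P_sets by (simp add: avg_def prod_haar_def nn_integral_completion P_def)
      also have "\<dots> \<le> ennreal \<kappa> * N g * emeasure ?M P / emeasure ?M P"
        by (rule divide_right_mono_ennreal[OF int_le])
      also have "\<dots> = ennreal \<kappa> * N g"
        using P_pos by (intro mult_divide_eq_ennreal) auto
      finally have lt: "ennreal lam < ennreal \<kappa> * N g" .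
      have "ennreal (lam / \<kappa>) < N g"
      proof (rule ccontr)
        assume "\<not> ennreal (lam / \<kappa>) < N g"
        then have "ennreal \<kappa> * N g \<le> ennreal \<kappa> * ennreal (lam / \<kappa>)"
          by (intro mult_left_mono) (simp_all add: linorder_not_less)
        also have "\<dots> = ennreal lam"
          using \<kappa> lam by (simp add: ennreal_mult[symmetric])
        finally show False using lt by simp
      qed
      moreover have "g \<in> space ?M"
        using *(6) X.dball_subset_space[of x1 r1] Y.dball_subset_space[of x2 r2]
        by (auto simp: space_pair_measure)
      ultimately show "g \<in> {z \<in> space ?M. ennreal (lam / \<kappa>) < N z}" by simp
    qed
    then have "emeasure ?M E \<le> emeasure ?M {z \<in> space ?M. ennreal (lam / \<kappa>) < N z}"
      unfolding N_def by (rule emeasure_mono) measurable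
    also have "\<dots> \<le> ennreal C * (\<integral>\<^sup>+z. ennreal (Phi (\<bar>f' z\<bar> / lam)) \<partial>?M)"
      unfolding N_def C_def by (rule iterated_maximal_llogl[OF _ _ lam \<kappa>]) simp_all
    also have "(\<integral>\<^sup>+z. ennreal (Phi (\<bar>f' z\<bar> / lam)) \<partial>?M) = (\<integral>\<^sup>+z. ennreal (Phi \<bar>f z / lam\<bar>) \<partial>?M)"
      by (rule nn_integral_cong_AE) (use ae lam in \<open>auto elim!: eventually_mono\<close>)
    also have "\<dots> = F_Phi exp1 exp2 (\<lambda>g. f g / lam)"
      by (simp add: F_Phi_def prod_haar_def nn_integral_completion)
    finally have "emeasure ?M E \<le> ennreal C * F_Phi exp1 exp2 (\<lambda>g. f g / lam)" .
    then show ?thesis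
      using E_sets unfolding E_def[symmetric] by (simp add: prod_haar_def)
  qed
  show ?thesis
  proof (intro exI[of _ C] conjI allI impI ballI)
    show "0 < C" by (rule C)
    fix lam :: real and f assume lam: "0 < lam" and "f \<in> L_log_L G1 exp1 G2 exp2"
    then have "f \<in> borel_measurable (prod_haar exp1 exp2)"
      by (simp add: L_log_L_def L1_loc_def)
    from main[OF lam this] show "let E = {g \<in> carrier G1 \<times> carrier G2.
          strong_maximal G1 exp1 \<rho>1 G2 exp2 \<rho>2 f g > ennreal lam}
        in E \<in> sets (prod_haar exp1 exp2) \<and>
          emeasure (prod_haar exp1 exp2) E \<le> ennreal C * F_Phi exp1 exp2 (\<lambda>g. f g / lam)"
      unfolding Let_def .
  qed
qed

end
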